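(* Let $f$ and $g$ be two post-critically finite branched coverings of degree at least $2$ on the topological sphere $\mathbb{S}^2$, with post-critical sets $P_f$ and $P_g$. Suppose $f$ and $g$ are combinatorially equivalent, via orientation-preserving homeomorphisms $\psi_0,\psi_1$ of $\mathbb{S}^2$ with $\psi_0\circ f=g\circ\psi_1$ (satisfying the conditions of combinatorial equivalence listed in the context). Then for any base point $t\in\mathbb{S}^2\setminus P_f$, $$(\psi_0)_\star\big(\mathrm{IMG}(f,t)\big)=\mathrm{IMG}(g,\psi_0(t)).$$ More precisely, for every loop $\gamma$ in $\mathbb{S}^2\setminus P_f$ with base point $t$, the monodromy action induced by $[\psi_0\circ\gamma]$ on the tree of preimages $T(g,\psi_0(t))$ is the same as the one induced by $[\gamma]$ on the tree of preimages $T(f,t)$, up to conjugation by a tree isomorphism $T(f,t)\to T(g,\psi_0(t))$.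
   Context: Post-critical set: for a branched covering $f:\mathbb{S}^2\to\mathbb{S}^2$, $P_f=\bigcup_{n\ge1}f^n(\text{critical points of }f)$; $f$ is post-critically finite if $P_f$ is finite. Then $P_f\subset f^{-1}(P_f)$ and $f$ restricts to a covering $f:\mathbb{S}^2\setminus f^{-1}(P_f)\to\mathbb{S}^2\setminus P_f$ of degree $d=\deg f$ (a "partial self-covering" of $\mathbb{S}^2\setminus P_f$), and likewise for the iterates $f^n:\mathbb{S}^2\setminus f^{-n}(P_f)\to\mathbb{S}^2\setminus P_f$. Combinatorial equivalence: $f$ and $g$ are combinatorially equivalent if there exist orientation-preserving homeomorphisms $\psi_0,\psi_1$ of $\mathbb{S}^2$ such that (i) $\psi_0\circ f=g\circ\psi_1$; (ii) $\psi_0(P_f)=\psi_1(P_f)=P_g$ and $\psi_0|_{P_f}=\psi_1|_{P_f}$; (iii) $\psi_0$ is isotopic to $\psi_1$ relatively to $P_f$. Tree of preimages: for $t\in\mathbb{S}^2\setminus P_f$, $T(f,t)$ is the rooted tree with root $t$, vertex set the abstract disjoint union $\bigsqcup_{n\ge0}f^{-n}(t)$ (the same point occurring in two levels gives two distinct vertices), and edges all pairs $\{f(x),x\}$ with $f(x)\in f^{-n}(t)$, $x\in f^{-(n+1)}(t)$, $n\ge0$. The level $n$ is $f^{-n}(t)$. A tree isomorphism between rooted trees is a bijection of vertices that preserves levels and adjacency. Monodromy action: for $[\gamma]\in\pi_1(\mathbb{S}^2\setminus P_f,t)$ and $x\in f^{-n}(t)$, $[\gamma]x$ is the terminal point of the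 $f^n$-lift of $\gamma$ starting at $x$. This gives a homomorphism $\Phi_f:\pi_1(\mathbb{S}^2\setminus P_f,t)\to\mathrm{Aut}(T(f,t))$, $[\gamma]\mapsto(x\mapsto[\gamma]x)$ (concatenation of loops and composition of automorphisms are both written with the first-performed factor on the left). The iterated monodromy group is $\mathrm{IMG}(f,t)=\pi_1(\mathbb{S}^2\setminus P_f,t)/\mathrm{Ker}(\Phi_f)$. Push-forward: $(\psi_0)_\star:[\gamma]\mapsto[\psi_0\circ\gamma]$ is a group isomorphism $\pi_1(\mathbb{S}^2\setminus P_f,t)\to\pi_1(\mathbb{S}^2\setminus P_g,\psi_0(t))$. It induces an isomorphism, still denoted $(\psi_0)_\star$, from $\mathrm{IMG}(f,t)$ onto the quotient $\pi_1(\mathbb{S}^2\setminus P_g,\psi_0(t))/(\psi_0)_\star(\mathrm{Ker}(\Phi_f))$. The displayed equality means that this quotient is $\mathrm{IMG}(g,\psi_0(t))$, i.e. $(\psi_0)_\star(\mathrm{Ker}(\Phi_f))=\mathrm{Ker}(\Phi_g)$. *)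

theory Defs
  imports
    "HOL-Analysis.Analysis"
    "HOL-Algebra.Coset"
    "HOL-Homology.Homology"
begin

section \<open>The sphere and orientation\<close>

abbreviation S2 :: "(real^3) set"
  where "S2 \<equiv> sphere 0 1"

text \<open>The library's Brouwer degree is defined for self-maps of \<^term>\<open>nsphere 2\<close>, the unit
  sphere in the first three coordinates of sequence space. We transport maps of \<^term>\<open>S2\<close>
  there; the degree of a self-map does not depend on the identification.\<close>

definition to_nsphere :: "real^3 \<Rightarrow> nat \<Rightarrow> real"
  where "to_nsphere x = (\<lambda>i. if i = 0 then x$1 else if i = 1 then x$2 else if i = 2 then x$3 else 0)"

definition from_nsphere :: "(nat \<Rightarrow> real) \<Rightarrow> real^3"
  where "from_nsphere y = vector [y 0, y 1, y 2]"

lemma homeomorphic_maps_nsphere: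
  "homeomorphic_maps (top_of_set S2) (nsphere 2) to_nsphere from_nsphere"
  unfolding homeomorphic_maps_def
proof (intro conjI)
  have norm3: "x \<in> S2 \<longleftrightarrow> (x$1)\<^sup>2 + (x$2)\<^sup>2 + (x$3)\<^sup>2 = 1" for x :: "real^3"
    by (simp add: norm_vec_def L2_set_def sum_3)
  have top: "topspace (nsphere 2) = {x. (x 0)\<^sup>2 + (x 1)\<^sup>2 + (x 2)\<^sup>2 = 1 \<and> (\<forall>i>2. x i = 0)}"
    by (simp add: nsphere numeral_2_eq_2)
  show "continuous_map (top_of_set S2) (nsphere 2) to_nsphere"
    unfolding nsphere
  proof (rule continuous_map_into_subtopology)
    show "continuous_map (top_of_set S2) (powertop_real UNIV) to_nsphere"
      unfolding continuous_map_componentwise_UNIV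
    proof
      fix k :: nat
      consider "k = 0" | "k = 1" | "k = 2" | "k > 2"
        by linarith
      then show "continuous_map (top_of_set S2) euclideanreal (\<lambda>x. to_nsphere x k)"
        by cases (auto simp: to_nsphere_def intro!: continuous_intros)
    qed
    show "to_nsphere \<in> topspace (top_of_set S2) \<rightarrow> {x. (\<Sum>i\<le>2. (x i)\<^sup>2) = 1 \<and> (\<forall>i>2. x i = 0)}"
      using norm3 by (simp add: Pi_iff numeral_2_eq_2 to_nsphere_def del: mem_sphere_0)
  qed
  show "continuous_map (nsphere 2) (top_of_set S2) from_nsphere"
  proof (rule continuous_map_into_subtopology)
    have comp: "continuous_map (nsphere 2) euclideanreal (\<lambda>y. from_nsphere y $ i)" for i
      by (rule exhaust_3[of i, THEN disjE])
        (auto simp: from_nsphere_def continuous_map_nsphere_projection)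
    have "continuous_map (nsphere 2) euclidean (\<lambda>y. \<Sum>i\<in>UNIV. (from_nsphere y $ i) *\<^sub>R axis i (1::real))"
      by (intro continuous_map_sum finite_UNIV)
        (auto intro!: continuous_map_compose[OF comp, of euclidean "\<lambda>r. r *\<^sub>R axis _ 1", unfolded o_def]
          continuous_intros)
    moreover have "(\<Sum>i\<in>UNIV. (from_nsphere y $ i) *\<^sub>R axis i (1::real)) = from_nsphere y" for y
      by (simp add: vec_eq_iff axis_def if_distrib cong: if_cong)
    ultimately show "continuous_map (nsphere 2) euclidean from_nsphere"
      by simp
    show "from_nsphere \<in> topspace (nsphere 2) \<rightarrow> S2"
      unfolding Pi_iff top norm3 by (simp add: from_nsphere_def)
  qed
  show "\<forall>x\<in>topspace (top_of_set S2). from_nsphere (to_nsphere x) = x"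
    by (simp add: from_nsphere_def to_nsphere_def vec_eq_iff forall_3)
  show "\<forall>y\<in>topspace (nsphere 2). to_nsphere (from_nsphere y) = y"
    by (auto simp: top from_nsphere_def to_nsphere_def fun_eq_iff)
qed

definition sphere_homeo :: "(real^3 \<Rightarrow> real^3) \<Rightarrow> bool"
  where "sphere_homeo h \<longleftrightarrow> (\<exists>k. homeomorphism S2 S2 h k)"

definition orientation_preserving_homeo :: "(real^3 \<Rightarrow> real^3) \<Rightarrow> bool"
  where "orientation_preserving_homeo h \<longleftrightarrow>
    sphere_homeo h \<and> Brouwer_degree2 2 (to_nsphere \<circ> h \<circ> from_nsphere) = 1"


section \<open>Branched coverings\<close>

text \<open>In suitable coordinates, \<open>f : U \<rightarrow> V\<close> is \<open>z \<mapsto> z^k\<close> on the open unit disk, with \<open>y\<close>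
  corresponding to the origin of the target.\<close>

definition power_model ::
    "(real^3 \<Rightarrow> real^3) \<Rightarrow> (real^3) set \<Rightarrow> (real^3) set \<Rightarrow> real^3 \<Rightarrow> nat \<Rightarrow> bool"
  where "power_model f U V y k \<longleftrightarrow>
    (\<exists>\<phi> \<phi>' \<psi> \<psi>'. homeomorphism U (ball (0::complex) 1) \<phi> \<phi>' \<and>
       homeomorphism V (ball (0::complex) 1) \<psi> \<psi>' \<and> \<psi> y = 0 \<and>
       (\<forall>x\<in>U. f x \<in> V \<and> \<psi> (f x) = \<phi> x ^ k))"

text \<open>Every point has a neighbourhood that is evenly covered in the branched sense.
  No compatibility with an orientation is required.\<close>

definition branched_covering :: "(real^3 \<Rightarrow> real^3) \<Rightarrow> bool"
  where "branched_covering f \<longleftrightarrow>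
    continuous_on S2 f \<and> f ` S2 = S2 \<and>
    (\<forall>y\<in>S2. \<exists>V \<U>. openin (top_of_set S2) V \<and> y \<in> V \<and>
       \<Union>\<U> = S2 \<inter> f -` V \<and> pairwise disjnt \<U> \<and>
       (\<forall>U\<in>\<U>. openin (top_of_set S2) U \<and> (\<exists>k>0. power_model f U V y k)))"

definition critical_points :: "(real^3 \<Rightarrow> real^3) \<Rightarrow> (real^3) set"
  where "critical_points f =
    {c \<in> S2. \<not> (\<exists>U. openin (top_of_set S2) U \<and> c \<in> U \<and> inj_on f U)}"

text \<open>The common number of preimages of all points that are not critical values.\<close>

definition covering_degree :: "(real^3 \<Rightarrow> real^3) \<Rightarrow> nat"
  where "covering_degree f =
    (THE d. \<forall>y \<in> S2 - f ` critical_points f. card {x \<in> S2. f x = y} = d)"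

definition postcritical_set :: "(real^3 \<Rightarrow> real^3) \<Rightarrow> (real^3) set"
  where "postcritical_set f = (\<Union>n\<in>{1..}. (f ^^ n) ` critical_points f)"

definition postcritically_finite :: "(real^3 \<Rightarrow> real^3) \<Rightarrow> bool"
  where "postcritically_finite f \<longleftrightarrow> finite (postcritical_set f)"

abbreviation punctured :: "(real^3 \<Rightarrow> real^3) \<Rightarrow> (real^3) set"
  where "punctured f \<equiv> S2 - postcritical_set f"

definition isotopic_rel ::
    "(real^3) set \<Rightarrow> (real^3 \<Rightarrow> real^3) \<Rightarrow> (real^3 \<Rightarrow> real^3) \<Rightarrow> bool"
  where "isotopic_rel A \<psi>\<^sub>0 \<psi>\<^sub>1 \<longleftrightarrow>
    homotopic_with (\<lambda>h. sphere_homeo h \<and> (\<forall>p\<in>A. h p = \<psi>\<^sub>0 p))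
      (top_of_set S2) (top_of_set S2) \<psi>\<^sub>0 \<psi>\<^sub>1"

definition combinatorial_equivalence ::
    "(real^3 \<Rightarrow> real^3) \<Rightarrow> (real^3 \<Rightarrow> real^3) \<Rightarrow> (real^3 \<Rightarrow> real^3) \<Rightarrow> (real^3 \<Rightarrow> real^3) \<Rightarrow> bool"
  where "combinatorial_equivalence f g \<psi>\<^sub>0 \<psi>\<^sub>1 \<longleftrightarrow>
    orientation_preserving_homeo \<psi>\<^sub>0 \<and> orientation_preserving_homeo \<psi>\<^sub>1 \<and>
    (\<forall>x\<in>S2. \<psi>\<^sub>0 (f x) = g (\<psi>\<^sub>1 x)) \<and>
    \<psi>\<^sub>0 ` postcritical_set f = postcritical_set g \<and>
    \<psi>\<^sub>1 ` postcritical_set f = postcritical_set g \<and>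
    (\<forall>p \<in> postcritical_set f. \<psi>\<^sub>0 p = \<psi>\<^sub>1 p) \<and>
    isotopic_rel (postcritical_set f) \<psi>\<^sub>0 \<psi>\<^sub>1"


section \<open>Fundamental group\<close>

definition based_loops :: "'a::topological_space set \<Rightarrow> 'a \<Rightarrow> (real \<Rightarrow> 'a) set"
  where "based_loops X t =
    {\<gamma>. path \<gamma> \<and> path_image \<gamma> \<subseteq> X \<and> pathstart \<gamma> = t \<and> pathfinish \<gamma> = t}"

definition loop_class :: "'a::topological_space set \<Rightarrow> (real \<Rightarrow> 'a) \<Rightarrow> (real \<Rightarrow> 'a) set"
  where "loop_class X \<gamma> = {\<delta>. homotopic_paths X \<gamma> \<delta>}"

text \<open>Operations on classes are written as unions over all representatives; since all members of
  such a union coincide, the union is the class of any one of them.\<close>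

definition fundamental_group :: "'a::real_normed_vector set \<Rightarrow> 'a \<Rightarrow> (real \<Rightarrow> 'a) set monoid"
  where "fundamental_group X t =
    \<lparr>carrier = loop_class X ` based_loops X t,
     mult = (\<lambda>A B. \<Union>\<gamma>\<in>A. \<Union>\<delta>\<in>B. loop_class X (\<gamma> +++ \<delta>)),
     one = loop_class X (linepath t t)\<rparr>"

definition push_forward ::
    "'b::topological_space set \<Rightarrow> ('a \<Rightarrow> 'b) \<Rightarrow> (real \<Rightarrow> 'a) set \<Rightarrow> (real \<Rightarrow> 'b) set"
  where "push_forward Y \<psi> A = (\<Union>\<gamma>\<in>A. loop_class Y (\<psi> \<circ> \<gamma>))"


section \<open>Tree of preimages and monodromy\<close>

text \<open>The first component of a vertex is its level.\<close>

definition tree_vertices :: "(real^3 \<Rightarrow> real^3) \<Rightarrow> real^3 \<Rightarrow> (nat \<times> (real^3)) set"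
  where "tree_vertices f t = {(n, x). x \<in> S2 \<and> (f ^^ n) x = t}"

definition tree_edges :: "(real^3 \<Rightarrow> real^3) \<Rightarrow> real^3 \<Rightarrow> (nat \<times> (real^3)) set set"
  where "tree_edges f t = {{(n, f x), (Suc n, x)} | n x. (Suc n, x) \<in> tree_vertices f t}"

definition tree_isomorphism ::
    "(real^3 \<Rightarrow> real^3) \<Rightarrow> real^3 \<Rightarrow> (real^3 \<Rightarrow> real^3) \<Rightarrow> real^3 \<Rightarrow>
     (nat \<times> (real^3) \<Rightarrow> nat \<times> (real^3)) \<Rightarrow> bool"
  where "tree_isomorphism f t g s h \<longleftrightarrow>
    bij_betw h (tree_vertices f t) (tree_vertices g s) \<and>
    (\<forall>v \<in> tree_vertices f t. fst (h v) = fst v) \<and>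
    (\<forall>u \<in> tree_vertices f t. \<forall>v \<in> tree_vertices f t.
       {u, v} \<in> tree_edges f t \<longleftrightarrow> {h u, h v} \<in> tree_edges g s)"

text \<open>The first factor of a product is applied first.\<close>

definition tree_aut_group ::
    "(real^3 \<Rightarrow> real^3) \<Rightarrow> real^3 \<Rightarrow> (nat \<times> (real^3) \<Rightarrow> nat \<times> (real^3)) monoid"
  where "tree_aut_group f t =
    \<lparr>carrier = {h \<in> extensional (tree_vertices f t). tree_isomorphism f t f t h},
     mult = (\<lambda>h k. compose (tree_vertices f t) k h),
     one = (\<lambda>v\<in>tree_vertices f t. v)\<rparr>"

definition is_lift ::
    "(real^3 \<Rightarrow> real^3) \<Rightarrow> nat \<Rightarrow> (real \<Rightarrow> real^3) \<Rightarrow> (real \<Rightarrow> real^3) \<Rightarrow> bool"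
  where "is_lift f n \<gamma> \<sigma> \<longleftrightarrow>
    path \<sigma> \<and> path_image \<sigma> \<subseteq> S2 \<inter> (f ^^ n) -` punctured f \<and>
    (\<forall>s\<in>{0..1}. (f ^^ n) (\<sigma> s) = \<gamma> s)"

definition monodromy_endpoint ::
    "(real^3 \<Rightarrow> real^3) \<Rightarrow> nat \<Rightarrow> (real \<Rightarrow> real^3) set \<Rightarrow> real^3 \<Rightarrow> real^3"
  where "monodromy_endpoint f n A x =
    (THE y. \<exists>\<gamma>\<in>A. \<exists>\<sigma>. is_lift f n \<gamma> \<sigma> \<and> pathstart \<sigma> = x \<and> pathfinish \<sigma> = y)"

definition monodromy ::
    "(real^3 \<Rightarrow> real^3) \<Rightarrow> real^3 \<Rightarrow> (real \<Rightarrow> real^3) set \<Rightarrow> nat \<times> (real^3) \<Rightarrow> nat \<times> (real^3)"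
  where "monodromy f t A = (\<lambda>(n, x)\<in>tree_vertices f t. (n, monodromy_endpoint f n A x))"

definition monodromy_kernel :: "(real^3 \<Rightarrow> real^3) \<Rightarrow> real^3 \<Rightarrow> (real \<Rightarrow> real^3) set set"
  where "monodromy_kernel f t =
    kernel (fundamental_group (punctured f) t) (tree_aut_group f t) (monodromy f t)"

definition IMG :: "(real^3 \<Rightarrow> real^3) \<Rightarrow> real^3 \<Rightarrow> (real \<Rightarrow> real^3) set set monoid"
  where "IMG f t = fundamental_group (punctured f) t Mod monodromy_kernel f t"

end

theory Submission
  imports Defs
begin

text \<open>Away from the postcritical sets, \<open>f\<close> and \<open>g\<close> are coverings
  (\<open>branched_covering_covering_space\<close>): over a point that is not a critical value every local
  model has exponent 1. Write \<open>A n\<close> and \<open>B n\<close> for the preimages of the complements of the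
  postcritical sets under \<open>f\<^sup>n\<close> and \<open>g\<^sup>n\<close>; both sequences decrease. Lifting a path
  through \<open>f\<^sup>n\<close> is done by lifting it \<open>n\<close> times through \<open>f\<close>, so the coverings of the
  iterates need not be constructed.

  The heart of the argument is a sequence of bijections \<open>\<psi> n : A n \<rightarrow> B n\<close> with \<open>\<psi> 0 = \<psi>\<^sub>0\<close>
  and \<open>g \<circ> \<psi> (n + 1) = \<psi> n \<circ> f\<close> (\<open>level_conjugacies\<close>). The isotopy from \<open>\<psi>\<^sub>0\<close> to
  \<open>\<psi>\<^sub>1\<close> restricts to a homotopy \<open>H 0\<close> from \<open>A 0\<close> to \<open>B 0\<close>, because all
  its maps agree with \<open>\<psi>\<^sub>0\<close> on the postcritical set. Since \<open>g \<circ> \<psi>\<^sub>1 = \<psi>\<^sub>0 \<circ> f\<close>, the homotopy \<open>H 0 (s, f x)\<close> lifts through \<open>g\<close> to a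
  homotopy \<open>H 1\<close> that starts at \<open>\<psi>\<^sub>1\<close>; its final map is \<open>\<psi> 2\<close>, and the construction repeats
  (\<open>level_homotopy_lift\<close>). The maps \<open>\<psi> n\<close> are not extended over the preimages of the
  postcritical sets: bijectivity is read off from unique path lifting along the tracks of the
  homotopies.

  On the fibres over the base points the \<open>\<psi> n\<close> form a tree isomorphism, and they map lifts of \<open>\<gamma>\<close>
  to lifts of \<open>\<psi>\<^sub>0 \<circ> \<gamma>\<close>; hence they conjugate the two monodromy actions
  (\<open>monodromy_conjugate\<close>). A class therefore acts trivially exactly when its push-forward does,
  so the push-forward, an isomorphism of fundamental groups, matches the two kernels and induces
  an isomorphism of the quotients.\<close>

section \<open>The covering of the complement of the postcritical set\<close>

text \<open>The domain of the partial covering given by the \<open>n\<close>-th iterate of \<open>f\<close>.\<close>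

definition level_domain :: "(real^3 \<Rightarrow> real^3) \<Rightarrow> nat \<Rightarrow> (real^3) set"
  where "level_domain f n = {x \<in> S2. (f ^^ n) x \<in> punctured f}"

lemma branched_covering_S2: "branched_covering f \<Longrightarrow> x \<in> S2 \<Longrightarrow> f x \<in> S2"
  unfolding branched_covering_def by blast

lemma branched_covering_funpow_S2:
  assumes "branched_covering f" "x \<in> S2"
  shows "(f ^^ n) x \<in> S2"
  by (induction n) (use assms branched_covering_S2 in auto)

lemma postcritical_set_forward_invariant:
  assumes "p \<in> postcritical_set f"
  shows "f p \<in> postcritical_set f"
proof -
  obtain n c where "n \<ge> 1" "c \<in> critical_points f" "p = (f ^^ n) c"
    using assms unfolding postcritical_set_def by blast
  then have "f p = (f ^^ Suc n) c" "Suc n \<in> {1..}"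
    by auto
  with \<open>c \<in> critical_points f\<close> show ?thesis
    unfolding postcritical_set_def by blast
qed

lemma critical_value_postcritical: "c \<in> critical_points f \<Longrightarrow> f c \<in> postcritical_set f"
  unfolding postcritical_set_def by (force intro!: bexI[of _ 1])

lemma postcritical_set_subset_S2:
  assumes "branched_covering f"
  shows "postcritical_set f \<subseteq> S2"
  unfolding postcritical_set_def critical_points_def
  using branched_covering_funpow_S2[OF assms] by blast

lemma level_domain_0 [simp]: "level_domain f 0 = punctured f"
  by (auto simp: level_domain_def)

lemma level_domain_Suc:
  assumes "branched_covering f"
  shows "level_domain f (Suc n) = {x \<in> S2. f x \<in> level_domain f n}"
  using branched_covering_S2[OF assms]
  unfolding level_domain_def funpow_Suc_right o_def by blast

lemma level_domain_Suc_subset: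
  assumes "branched_covering f"
  shows "level_domain f (Suc n) \<subseteq> level_domain f n"
  using postcritical_set_forward_invariant branched_covering_funpow_S2[OF assms]
  unfolding level_domain_def by auto

lemma level_domain_subset:
  assumes "branched_covering f" "m \<le> n"
  shows "level_domain f n \<subseteq> level_domain f m"
  using \<open>m \<le> n\<close> level_domain_Suc_subset[OF assms(1)]
  by (induction rule: dec_induct) auto

text \<open>If the point of \<open>U\<close> over the centre \<open>y\<close> is not critical, the exponent of the local model is 1:
  for \<open>k > 1\<close> a small point and its product with a nontrivial \<open>k\<close>-th root of unity have the same
  image.\<close>

lemma power_model_homeomorphism:
  assumes pm: "power_model f U V y k" and "k > 0" and "y \<in> V"
    and ope: "openin (top_of_set S2) U"
    and noncrit: "\<And>x. x \<in> U \<Longrightarrow> f x = y \<Longrightarrow> x \<notin> critical_points f"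
  shows "\<exists>q. homeomorphism U V f q"
proof -
  obtain \<phi> \<phi>' \<psi> \<psi>' where \<phi>: "homeomorphism U (ball (0::complex) 1) \<phi> \<phi>'"
    and \<psi>: "homeomorphism V (ball (0::complex) 1) \<psi> \<psi>'" and \<psi>y: "\<psi> y = 0"
    and fV: "\<And>x. x \<in> U \<Longrightarrow> f x \<in> V" and \<psi>f: "\<And>x. x \<in> U \<Longrightarrow> \<psi> (f x) = \<phi> x ^ k"
    using pm unfolding power_model_def by blast
  have inj\<psi>: "u = v" if "u \<in> V" "v \<in> V" "\<psi> u = \<psi> v" for u v
    using that \<psi> by (metis homeomorphism_apply1)
  define x where "x = \<phi>' 0"
  have xU: "x \<in> U" and \<phi>x: "\<phi> x = 0"
    using \<phi> homeomorphism_image2[OF \<phi>] homeomorphism_apply2[OF \<phi>, of 0] unfolding x_def by auto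
  have "f x = y"
    using inj\<psi>[OF fV[OF xU] \<open>y \<in> V\<close>] \<psi>f[OF xU] \<phi>x \<psi>y \<open>k > 0\<close> by simp
  moreover have "x \<in> S2"
    using ope xU openin_imp_subset by blast
  ultimately obtain W where W: "openin (top_of_set S2) W" "x \<in> W" and injW: "inj_on f W"
    using noncrit[OF xU] unfolding critical_points_def by blast
  have "k = 1"
  proof (rule ccontr)
    assume "k \<noteq> 1"
    with \<open>k > 0\<close> have "1 \<le> k" "\<not> k dvd 1"
      by auto
    define \<omega> where "\<omega> = exp (2 * of_real pi * \<i> * of_nat 1 / of_nat k)"
    have \<omega>1: "\<omega> \<noteq> 1"
      unfolding \<omega>_def using complex_root_unity_eq_1[OF \<open>1 \<le> k\<close>, of 1] \<open>\<not> k dvd 1\<close> by blast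
    have \<omega>k: "\<omega> ^ k = 1"
      unfolding \<omega>_def using complex_root_unity[of k 1] \<open>k > 0\<close> by simp
    have n\<omega>: "norm \<omega> = 1"
      unfolding \<omega>_def norm_exp_eq_Re by simp
    have "openin (top_of_set U) (U \<inter> W)"
    proof -
      obtain T where "open T" "W = S2 \<inter> T"
        using W(1) unfolding openin_open by blast
      moreover have "U \<subseteq> S2"
        using ope openin_imp_subset by blast
      ultimately have "open T" "U \<inter> W = U \<inter> T"
        by blast+
      then show ?thesis
        unfolding openin_open by blast
    qed
    then have "openin (top_of_set (ball 0 1)) (\<phi> ` (U \<inter> W))"
      by (rule homeomorphism_imp_open_map[OF \<phi>])
    then have "open (\<phi> ` (U \<inter> W))"
      using openin_open_trans by blast
    moreover have "0 \<in> \<phi> ` (U \<inter> W)"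
      using xU W(2) \<phi>x by force
    ultimately obtain e where e: "e > 0" "ball 0 e \<subseteq> \<phi> ` (U \<inter> W)"
      by (meson open_contains_ball)
    define z where "z = complex_of_real (e / 2)"
    have "z \<in> ball 0 e" "\<omega> * z \<in> ball 0 e"
      using e(1) n\<omega> by (auto simp: z_def norm_mult)
    then have "z \<in> \<phi> ` (U \<inter> W)" "\<omega> * z \<in> \<phi> ` (U \<inter> W)"
      using e(2) by blast+
    then obtain u v where u: "u \<in> U \<inter> W" "\<phi> u = z" and v: "v \<in> U \<inter> W" "\<phi> v = \<omega> * z"
      by (metis imageE)
    have "\<psi> (f u) = \<psi> (f v)"
      using u v \<psi>f \<omega>k by (simp add: power_mult_distrib)
    then have "f u = f v"
      using u v inj\<psi> fV by blast
    then have "u = v"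
      using injW u v by (meson IntE inj_onD)
    then have "\<omega> * z = z"
      using u v by simp
    then show False
      using \<omega>1 e(1) by (simp add: z_def)
  qed
  have "homeomorphism U V (\<psi>' \<circ> \<phi>) (\<phi>' \<circ> \<psi>)"
    using homeomorphism_compose[OF \<phi> homeomorphism_symD[OF \<psi>]] .
  moreover have "(\<psi>' \<circ> \<phi>) x = f x" if "x \<in> U" for x
    using \<psi>f[OF that] fV[OF that] \<open>k = 1\<close> homeomorphism_apply1[OF \<psi>] by (metis comp_apply power_one_right)
  ultimately have "homeomorphism U V f (\<phi>' \<circ> \<psi>)"
    unfolding homeomorphism_def by (auto cong: continuous_on_cong image_cong simp del: o_apply)
  then show ?thesis
    by blast
qed

lemma branched_covering_covering_space:
  assumes bc: "branched_covering f"
  shows "covering_space (level_domain f 1) f (punctured f)"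
proof
  have A1: "level_domain f 1 = {x \<in> S2. f x \<in> punctured f}"
    by (simp add: level_domain_def)
  show "continuous_on (level_domain f 1) f"
  proof (rule continuous_on_subset)
    show "continuous_on S2 f"
      using bc unfolding branched_covering_def by blast
    show "level_domain f 1 \<subseteq> S2"
      unfolding A1 by blast
  qed
  show "f ` level_domain f 1 = punctured f"
  proof -
    have "f ` S2 = S2"
      using bc unfolding branched_covering_def by blast
    show ?thesis
    proof
      show "f ` level_domain f 1 \<subseteq> punctured f"
        unfolding A1 by blast
      show "punctured f \<subseteq> f ` level_domain f 1"
      proof
        fix z assume z: "z \<in> punctured f"
        then obtain x where "x \<in> S2" "z = f x"
          using \<open>f ` S2 = S2\<close> by (metis DiffD1 imageE)
        then show "z \<in> f ` level_domain f 1"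
          using z unfolding A1 by blast
      qed
    qed
  qed
  fix y assume y: "y \<in> punctured f"
  obtain V \<U> where V: "openin (top_of_set S2) V" "y \<in> V" and \<U>: "\<Union>\<U> = S2 \<inter> f -` V"
    and dis: "pairwise disjnt \<U>"
    and opeU: "\<And>U. U \<in> \<U> \<Longrightarrow> openin (top_of_set S2) U"
    and pm: "\<And>U. U \<in> \<U> \<Longrightarrow> \<exists>k>0. power_model f U V y k"
    using bc y unfolding branched_covering_def by (metis DiffD1)
  let ?r = "\<lambda>U. U \<inter> level_domain f 1"
  show "\<exists>T. y \<in> T \<and> openin (top_of_set (punctured f)) T \<and>
      (\<exists>v. \<Union>v = level_domain f 1 \<inter> f -` T \<and>
        (\<forall>u\<in>v. openin (top_of_set (level_domain f 1)) u) \<and>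
        pairwise disjnt v \<and> (\<forall>u\<in>v. \<exists>q. homeomorphism u T f q))"
  proof (intro exI[of _ "V \<inter> punctured f"] exI[of _ "?r ` \<U>"] conjI ballI)
    show "y \<in> V \<inter> punctured f"
      using V y by blast
    show "openin (top_of_set (punctured f)) (V \<inter> punctured f)"
    proof -
      obtain T where "open T" "V = S2 \<inter> T"
        using V(1) unfolding openin_open by blast
      moreover from this have "V \<inter> punctured f = punctured f \<inter> T"
        by blast
      ultimately show ?thesis
        unfolding openin_open by blast
    qed
    show "\<Union>(?r ` \<U>) = level_domain f 1 \<inter> f -` (V \<inter> punctured f)"
      using \<U> unfolding A1 by blast
    show "pairwise disjnt (?r ` \<U>)"
      using dis unfolding pairwise_def disjnt_def by blast
    fix u assume "u \<in> ?r ` \<U>"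
    then obtain U where U: "U \<in> \<U>" "u = ?r U"
      by blast
    show "openin (top_of_set (level_domain f 1)) u"
    proof -
      obtain T where "open T" "U = S2 \<inter> T"
        using opeU[OF U(1)] unfolding openin_open by blast
      moreover from this have "u = level_domain f 1 \<inter> T"
        using U(2) unfolding A1 by blast
      ultimately show ?thesis
        unfolding openin_open by blast
    qed
    obtain k where k: "k > 0" "power_model f U V y k"
      using pm U(1) by blast
    have "x \<notin> critical_points f" if "f x = y" for x
      using critical_value_postcritical[of x f] that y by blast
    then obtain q where q: "homeomorphism U V f q"
      using power_model_homeomorphism[OF k(2,1) V(2) opeU[OF U(1)]] by blast
    have "f ` u = V \<inter> punctured f"
    proof
      show "f ` u \<subseteq> V \<inter> punctured f"
        using \<U> U unfolding A1 by blast
      show "V \<inter> punctured f \<subseteq> f ` u"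
      proof
        fix z assume z: "z \<in> V \<inter> punctured f"
        then obtain x where "x \<in> U" "f x = z"
          using homeomorphism_image1[OF q] by blast
        moreover have "x \<in> S2"
          using \<open>x \<in> U\<close> U \<U> by blast
        ultimately show "z \<in> f ` u"
          using z U(2) unfolding A1 by blast
      qed
    qed
    then have "homeomorphism u (V \<inter> punctured f) f q"
      using homeomorphism_of_subsets[OF q, of u "V \<inter> punctured f"] U(2) by blast
    then show "\<exists>q. homeomorphism u (V \<inter> punctured f) f q"
      by blast
  qed
qed

section \<open>Lifts of paths and the monodromy action\<close>

lemma is_lift_Suc:
  assumes bc: "branched_covering f" and lift: "is_lift f (Suc n) \<gamma> \<sigma>"
  shows "is_lift f n \<gamma> (f \<circ> \<sigma>)" and "path_image \<sigma> \<subseteq> level_domain f 1"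
proof -
  have \<sigma>: "path \<sigma>" "path_image \<sigma> \<subseteq> level_domain f (Suc n)"
    using lift unfolding is_lift_def level_domain_def by blast+
  then have im: "f ` path_image \<sigma> \<subseteq> level_domain f n"
    using level_domain_Suc[OF bc] by blast
  show "path_image \<sigma> \<subseteq> level_domain f 1"
    using \<sigma> level_domain_subset[OF bc, of 1 "Suc n"] by simp
  then have "continuous_on (path_image \<sigma>) f"
    using branched_covering_covering_space[OF bc] covering_space_imp_continuous
      continuous_on_subset by blast
  then have "path (f \<circ> \<sigma>)"
    using \<sigma> by (simp add: path_continuous_image)
  then show "is_lift f n \<gamma> (f \<circ> \<sigma>)"
    using lift im unfolding is_lift_def path_image_compose level_domain_def
    by (auto simp: funpow_swap1)
qed

text \<open>The homotopy is stated in the complement of the postcritical set, which contains all the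
  domains, so that the conclusion at level \<open>n\<close> is what the lifting step through \<open>f\<close> requires.\<close>

lemma lifts_homotopic:
  assumes bc: "branched_covering f" and hom: "homotopic_paths (punctured f) \<gamma> \<gamma>'"
    and "is_lift f n \<gamma> \<sigma>" and "is_lift f n \<gamma>' \<sigma>'" and "pathstart \<sigma> = pathstart \<sigma>'"
  shows "homotopic_paths (punctured f) \<sigma> \<sigma>'"
  using assms(3-5)
proof (induction n arbitrary: \<sigma> \<sigma>')
  case 0
  have "homotopic_paths (punctured f) \<sigma> \<gamma>" "homotopic_paths (punctured f) \<sigma>' \<gamma>'"
    using 0 unfolding is_lift_def by (auto intro!: homotopic_paths_eq)
  then show ?case
    using hom by (meson homotopic_paths_sym homotopic_paths_trans)
next
  case (Suc n)
  note l = is_lift_Suc[OF bc Suc.prems(1)] is_lift_Suc[OF bc Suc.prems(2)]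
  have h: "homotopic_paths (punctured f) (f \<circ> \<sigma>) (f \<circ> \<sigma>')"
    by (rule Suc.IH[OF l(1,3)]) (use Suc.prems(3) in \<open>simp add: pathstart_def\<close>)
  have "homotopic_paths (level_domain f 1) \<sigma> \<sigma>'"
  proof (rule covering_space_lift_homotopic_paths[OF branched_covering_covering_space[OF bc] _ _ _ _ h])
    show "path (f \<circ> \<sigma>)" "path (f \<circ> \<sigma>')"
      using l unfolding is_lift_def by auto
    show "path_image (f \<circ> \<sigma>) \<subseteq> punctured f" "path_image (f \<circ> \<sigma>') \<subseteq> punctured f"
      using h homotopic_paths_imp_subset by blast+
    show "path \<sigma>" "path \<sigma>'"
      using Suc.prems unfolding is_lift_def by auto
  qed (use l Suc.prems in auto)
  then show ?case
    using homotopic_paths_subset level_domain_subset[OF bc, of 0 1] by simp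
qed

lemma lift_exists:
  assumes bc: "branched_covering f" and \<gamma>: "path \<gamma>" "path_image \<gamma> \<subseteq> punctured f"
    and "x \<in> S2" "(f ^^ n) x = pathstart \<gamma>"
  obtains \<sigma> where "is_lift f n \<gamma> \<sigma>" "pathstart \<sigma> = x"
proof -
  have "\<exists>\<sigma>. is_lift f n \<gamma> \<sigma> \<and> pathstart \<sigma> = x"
    using assms(4,5)
  proof (induction n arbitrary: x)
    case 0
    then show ?case
      using \<gamma> by (intro exI[of _ \<gamma>]) (auto simp: is_lift_def)
  next
    case (Suc n)
    obtain \<sigma> where \<sigma>: "is_lift f n \<gamma> \<sigma>" "pathstart \<sigma> = f x"
      using Suc.IH[of "f x"] Suc.prems branched_covering_S2[OF bc] by (auto simp: funpow_swap1)
    have \<sigma>im: "path_image \<sigma> \<subseteq> level_domain f n"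
      using \<sigma> unfolding is_lift_def level_domain_def by blast
    then have im0: "path_image \<sigma> \<subseteq> punctured f"
      using level_domain_subset[OF bc, of 0 n] by auto
    then have "f x \<in> punctured f"
      using \<sigma>(2) pathstart_in_path_image[of \<sigma>] by auto
    then have "x \<in> level_domain f 1"
      using Suc.prems(1) by (simp add: level_domain_def)
    then obtain \<tau> where \<tau>: "path \<tau>" "path_image \<tau> \<subseteq> level_domain f 1" "pathstart \<tau> = x"
      and eq: "\<And>s. s \<in> {0..1} \<Longrightarrow> f (\<tau> s) = \<sigma> s"
      using covering_space_lift_path_strong[OF branched_covering_covering_space[OF bc] _ _ im0 \<sigma>(2)] \<sigma>(1)
      unfolding is_lift_def by metis
    have "\<tau> s \<in> level_domain f (Suc n)" if s: "s \<in> {0..1}" for s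
    proof -
      have "\<tau> s \<in> level_domain f 1" "\<sigma> s \<in> level_domain f n"
        using s \<tau>(2) \<sigma>im unfolding path_image_def by blast+
      then show ?thesis
        using eq[OF s] unfolding level_domain_Suc[OF bc] by (simp add: level_domain_def)
    qed
    then have "path_image \<tau> \<subseteq> S2 \<inter> (f ^^ Suc n) -` punctured f"
      unfolding path_image_def level_domain_def by blast
    moreover have "(f ^^ Suc n) (\<tau> s) = \<gamma> s" if "s \<in> {0..1}" for s
      using that \<sigma>(1) eq unfolding is_lift_def funpow_Suc_right by simp
    ultimately have "is_lift f (Suc n) \<gamma> \<tau>"
      using \<tau>(1) unfolding is_lift_def by blast
    then show ?case
      using \<tau>(3) by blast
  qed
  then show thesis
    using that by blast
qed

text \<open>The endpoint is independent of the representative of the class and of the lift.\<close>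

lemma monodromy_endpoint_eq:
  assumes bc: "branched_covering f" and lift: "is_lift f n \<gamma> \<sigma>"
    and \<gamma>: "path \<gamma>" "path_image \<gamma> \<subseteq> punctured f"
  shows "monodromy_endpoint f n (loop_class (punctured f) \<gamma>) (pathstart \<sigma>) = pathfinish \<sigma>"
  unfolding monodromy_endpoint_def
proof (rule the_equality)
  show "\<exists>\<delta>\<in>loop_class (punctured f) \<gamma>. \<exists>\<tau>. is_lift f n \<delta> \<tau> \<and>
      pathstart \<tau> = pathstart \<sigma> \<and> pathfinish \<tau> = pathfinish \<sigma>"
    using lift \<gamma> by (intro bexI[of _ \<gamma>] exI[of _ \<sigma>]) (auto simp: loop_class_def)
  fix y assume "\<exists>\<delta>\<in>loop_class (punctured f) \<gamma>. \<exists>\<tau>. is_lift f n \<delta> \<tau> \<and>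
      pathstart \<tau> = pathstart \<sigma> \<and> pathfinish \<tau> = y"
  then show "y = pathfinish \<sigma>"
    using lifts_homotopic[OF bc _ lift] homotopic_paths_imp_pathfinish
    unfolding loop_class_def by (metis mem_Collect_eq)
qed

lemma monodromy_lift:
  assumes bc: "branched_covering f" and \<gamma>: "\<gamma> \<in> based_loops (punctured f) t"
    and v: "(n, x) \<in> tree_vertices f t"
  obtains \<sigma> where "is_lift f n \<gamma> \<sigma>" "pathstart \<sigma> = x" "(n, pathfinish \<sigma>) \<in> tree_vertices f t"
    "monodromy f t (loop_class (punctured f) \<gamma>) (n, x) = (n, pathfinish \<sigma>)"
proof -
  have g: "path \<gamma>" "path_image \<gamma> \<subseteq> punctured f" "pathstart \<gamma> = t" "pathfinish \<gamma> = t"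
    using \<gamma> unfolding based_loops_def by auto
  obtain \<sigma> where \<sigma>: "is_lift f n \<gamma> \<sigma>" "pathstart \<sigma> = x"
    using lift_exists[OF bc g(1,2), of x n] v g(3) unfolding tree_vertices_def by auto
  show thesis
  proof
    show "is_lift f n \<gamma> \<sigma>" "pathstart \<sigma> = x"
      by fact+
    have "(f ^^ n) (pathfinish \<sigma>) = t" "pathfinish \<sigma> \<in> S2"
      using \<sigma>(1) g(4) pathfinish_in_path_image[of \<sigma>] unfolding is_lift_def
      by (auto simp: pathfinish_def)
    then show "(n, pathfinish \<sigma>) \<in> tree_vertices f t"
      by (simp add: tree_vertices_def)
    show "monodromy f t (loop_class (punctured f) \<gamma>) (n, x) = (n, pathfinish \<sigma>)"
      using monodromy_endpoint_eq[OF bc \<sigma>(1) g(1,2)] \<sigma>(2) v by (simp add: monodromy_def)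
  qed
qed

section \<open>Lifting the isotopy through all levels\<close>

text \<open>The data carried along the induction over the levels: a homotopy \<open>H\<close> between the domains of
  the \<open>n\<close>-th iterates, bijective at both ends. The last two clauses say that the end \<open>H (1, _)\<close> is
  itself a lift of the beginning \<open>H (0, _)\<close>, so that the next homotopy can start from \<open>H (1, _)\<close>.\<close>

definition level_homotopy ::
    "(real^3 \<Rightarrow> real^3) \<Rightarrow> (real^3 \<Rightarrow> real^3) \<Rightarrow> nat \<Rightarrow> (real \<times> (real^3) \<Rightarrow> real^3) \<Rightarrow> bool"
  where "level_homotopy f g n H \<longleftrightarrow>
    continuous_on ({0..1} \<times> level_domain f n) H \<and>
    H \<in> {0..1} \<times> level_domain f n \<rightarrow> level_domain g n \<and>
    bij_betw (\<lambda>x. H (0, x)) (level_domain f n) (level_domain g n) \<and>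
    bij_betw (\<lambda>x. H (1, x)) (level_domain f n) (level_domain g n) \<and>
    bij_betw (\<lambda>x. H (1, x)) (level_domain f (Suc n)) (level_domain g (Suc n)) \<and>
    (\<forall>x\<in>level_domain f (Suc n). g (H (1, x)) = H (0, f x))"

lemma combinatorial_equivalence_level_homotopy:
  assumes bf: "branched_covering f" and bg: "branched_covering g"
    and ce: "combinatorial_equivalence f g \<psi>\<^sub>0 \<psi>\<^sub>1"
  obtains H where "level_homotopy f g 0 H" "\<And>x. H (0, x) = \<psi>\<^sub>0 x"
proof -
  let ?P = "postcritical_set f"
  have hom: "\<forall>x\<in>S2. \<psi>\<^sub>0 (f x) = g (\<psi>\<^sub>1 x)" and P0: "\<psi>\<^sub>0 ` ?P = postcritical_set g"
    using ce unfolding combinatorial_equivalence_def by blast+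
  obtain H :: "real \<times> (real^3) \<Rightarrow> real^3"
    where contH: "continuous_map (prod_topology (top_of_set {0..1}) (top_of_set S2)) (top_of_set S2) H"
    and H0: "\<And>x. H (0, x) = \<psi>\<^sub>0 x" and H1: "\<And>x. H (1, x) = \<psi>\<^sub>1 x"
    and Hs: "\<And>s. s \<in> {0..1} \<Longrightarrow> sphere_homeo (\<lambda>x. H (s, x)) \<and> (\<forall>p\<in>?P. H (s, p) = \<psi>\<^sub>0 p)"
  proof -
    have "isotopic_rel ?P \<psi>\<^sub>0 \<psi>\<^sub>1"
      using ce unfolding combinatorial_equivalence_def by blast
    then show thesis
      unfolding isotopic_rel_def homotopic_with_def
    proof (elim exE conjE)
      fix h :: "real \<times> (real^3) \<Rightarrow> real^3"
      assume "continuous_map (prod_topology (top_of_set {0..1}) (top_of_set S2)) (top_of_set S2) h"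
        and "\<forall>x. h (0, x) = \<psi>\<^sub>0 x" and "\<forall>x. h (1, x) = \<psi>\<^sub>1 x"
        and "\<forall>s\<in>{0..1}. sphere_homeo (\<lambda>x. h (s, x)) \<and> (\<forall>p\<in>?P. h (s, p) = \<psi>\<^sub>0 p)"
      then show thesis
        by (intro that[of h]) blast+
    qed
  qed
  have sub: "punctured f \<subseteq> S2" and PS: "?P \<subseteq> S2"
    using postcritical_set_subset_S2[OF bf] by auto
  have bijS: "bij_betw (\<lambda>x. H (s, x)) S2 S2" if s: "s \<in> {0..1}" for s
  proof -
    obtain k where k: "homeomorphism S2 S2 (\<lambda>x. H (s, x)) k"
      using Hs[OF s] unfolding sphere_homeo_def by blast
    show ?thesis
      using homeomorphism_image1[OF k] homeomorphism_apply1[OF k]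
      by (intro bij_betw_imageI inj_on_inverseI[of _ k]) auto
  qed
  have bij: "bij_betw (\<lambda>x. H (s, x)) (punctured f) (punctured g)" if s: "s \<in> {0..1}" for s
  proof -
    have "(\<lambda>x. H (s, x)) ` ?P = postcritical_set g"
      using Hs[OF s] P0 by (metis (no_types, lifting) image_cong)
    then have "(\<lambda>x. H (s, x)) ` (S2 - ?P) = punctured g"
      using bijS[OF s] PS inj_on_image_set_diff[of "\<lambda>x. H (s, x)" S2 S2 ?P]
      by (simp add: bij_betw_def)
    then show ?thesis
      using bijS[OF s] sub by (metis bij_betw_def inj_on_subset)
  qed
  have "level_homotopy f g 0 H"
    unfolding level_homotopy_def level_domain_0
  proof (intro conjI)
    have "continuous_on ({0..1} \<times> S2) H"
      using contH by (simp add: prod_topology_subtopology_eu)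
    then show "continuous_on ({0..1} \<times> punctured f) H"
      by (rule continuous_on_subset) auto
    show "H \<in> {0..1} \<times> punctured f \<rightarrow> punctured g"
    proof
      fix z :: "real \<times> (real^3)"
      assume "z \<in> {0..1} \<times> punctured f"
      then show "H z \<in> punctured g"
        using bij_betwE[OF bij, of "fst z"] by (cases z) auto
    qed
    show "bij_betw (\<lambda>x. H (0, x)) (punctured f) (punctured g)"
      and b1: "bij_betw (\<lambda>x. H (1, x)) (punctured f) (punctured g)"
      using bij by auto
    show "\<forall>x\<in>level_domain f (Suc 0). g (H (1, x)) = H (0, f x)"
      using hom by (simp add: H0 H1 level_domain_def)
    \<comment> \<open>Compare with the postcritical sets through \<open>\<psi>\<^sub>0\<close>, which is injective on the whole sphere.\<close>
    have iff: "x \<in> level_domain f (Suc 0) \<longleftrightarrow> H (1, x) \<in> level_domain g (Suc 0)" if x: "x \<in> S2" for x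
    proof -
      have "f x \<in> S2" "\<psi>\<^sub>1 x \<in> S2"
        using x branched_covering_S2[OF bf] bij_betwE[OF bijS, of 1] by (auto simp: H1)
      moreover have "f x \<in> ?P \<longleftrightarrow> \<psi>\<^sub>0 (f x) \<in> postcritical_set g"
      proof -
        have "inj_on \<psi>\<^sub>0 S2"
          using bijS[of 0] by (simp add: H0 bij_betw_def)
        then show ?thesis
          using inj_on_image_mem_iff[of \<psi>\<^sub>0 S2 "f x" ?P] \<open>f x \<in> S2\<close> PS P0 by blast
      qed
      moreover have "\<psi>\<^sub>0 (f x) = g (\<psi>\<^sub>1 x)"
        using hom x by blast
      ultimately show ?thesis
        using x branched_covering_S2[OF bg, of "\<psi>\<^sub>1 x"] unfolding level_domain_def by (auto simp: H1)
    qed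
    show "bij_betw (\<lambda>x. H (1, x)) (level_domain f (Suc 0)) (level_domain g (Suc 0))"
    proof (rule bij_betw_subset[OF bijS[of 1]])
      show "(\<lambda>x. H (1, x)) ` level_domain f (Suc 0) = level_domain g (Suc 0)"
      proof
        show "(\<lambda>x. H (1, x)) ` level_domain f (Suc 0) \<subseteq> level_domain g (Suc 0)"
          using iff unfolding level_domain_def by blast
        show "level_domain g (Suc 0) \<subseteq> (\<lambda>x. H (1, x)) ` level_domain f (Suc 0)"
        proof
          fix y assume y: "y \<in> level_domain g (Suc 0)"
          then have "y \<in> S2"
            unfolding level_domain_def by blast
          moreover have "(\<lambda>x. H (1, x)) ` S2 = S2"
            using bijS[of 1] by (simp add: bij_betw_def)
          ultimately obtain x where "x \<in> S2" "y = H (1, x)"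
            by (metis (no_types, lifting) imageE)
          then show "y \<in> (\<lambda>x. H (1, x)) ` level_domain f (Suc 0)"
            using iff y by blast
        qed
      qed
    qed (auto simp: level_domain_def)
  qed
  then show thesis
    using that H0 by blast
qed

text \<open>Injectivity and surjectivity of the final map of the lifted homotopy both come from unique
  path lifting: each track \<open>s \<mapsto> K (s, x)\<close> is determined by either of its ends.\<close>

lemma level_homotopy_lift:
  assumes bf: "branched_covering f" and bg: "branched_covering g"
    and lh: "level_homotopy f g n H"
  obtains K where "level_homotopy f g (Suc n) K" "\<And>x. x \<in> level_domain f (Suc n) \<Longrightarrow> K (0, x) = H (1, x)"
proof -
  let ?A = "level_domain f" and ?B = "level_domain g"
  note cov = branched_covering_covering_space[OF bg]
  have contH: "continuous_on ({0..1} \<times> ?A n) H"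
    and Him: "H \<in> {0..1} \<times> ?A n \<rightarrow> ?B n"
    and bij0: "bij_betw (\<lambda>x. H (0, x)) (?A n) (?B n)"
    and bij1: "bij_betw (\<lambda>x. H (1, x)) (?A n) (?B n)"
    and bijS: "bij_betw (\<lambda>x. H (1, x)) (?A (Suc n)) (?B (Suc n))"
    and gH: "\<And>x. x \<in> ?A (Suc n) \<Longrightarrow> g (H (1, x)) = H (0, f x)"
    using lh unfolding level_homotopy_def by blast+
  have fA: "f x \<in> ?A n" if "x \<in> ?A (Suc n)" for x n
    using that level_domain_Suc[OF bf] by blast
  have gB: "g y \<in> ?B n" if "y \<in> ?B (Suc n)" for y n
    using that level_domain_Suc[OF bg] by blast
  have A: "?A (Suc n) \<subseteq> ?A n" for n
    by (rule level_domain_Suc_subset[OF bf])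
  have B0: "?B n \<subseteq> punctured g" and B1: "?B (Suc n) \<subseteq> ?B 1"
    using level_domain_subset[OF bg, of 0 n] level_domain_subset[OF bg, of 1 "Suc n"] by auto
  have "?A (Suc n) \<subseteq> ?A 1"
    using level_domain_subset[OF bf, of 1 "Suc n"] by simp
  then have contf: "continuous_on (?A (Suc n)) f"
    using covering_space_imp_continuous[OF branched_covering_covering_space[OF bf]]
      continuous_on_subset by blast
  define h where "h = (\<lambda>z. H (fst z, f (snd z)))"
  have h: "h (s, x) \<in> ?B n" if "s \<in> {0..1}" "x \<in> ?A (Suc n)" for s x
    using Him that fA unfolding h_def by auto
  have conth: "continuous_on ({0..1} \<times> ?A (Suc n)) h"
    unfolding h_def
  proof (rule continuous_on_compose2[OF contH])
    show "continuous_on ({0..1} \<times> ?A (Suc n)) (\<lambda>z. (fst z, f (snd z)))"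
      by (intro continuous_intros continuous_on_compose2[OF contf]) auto
  qed (use fA in auto)
  have him: "h \<in> {0..1} \<times> ?A (Suc n) \<rightarrow> punctured g"
    using h B0 by fastforce
  have h0: "h (0, x) = g (H (1, x))" if "x \<in> ?A (Suc n)" for x
    using gH[OF that] by (simp add: h_def)
  have cont1: "continuous_on (?A (Suc n)) (\<lambda>x. H (1, x))"
    by (rule continuous_on_compose2[OF contH]) (use A in \<open>auto intro!: continuous_intros\<close>)
  have im1: "(\<lambda>x. H (1, x)) \<in> ?A (Suc n) \<rightarrow> ?B 1"
    using bij_betwE[OF bijS] B1 by blast
  obtain K where contK: "continuous_on ({0..1} \<times> ?A (Suc n)) K"
    and Kim1: "K \<in> {0..1} \<times> ?A (Suc n) \<rightarrow> ?B 1"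
    and K0: "\<And>x. x \<in> ?A (Suc n) \<Longrightarrow> K (0, x) = H (1, x)"
    and gK: "\<And>z. z \<in> {0..1} \<times> ?A (Suc n) \<Longrightarrow> h z = g (K z)"
    using covering_space_lift_homotopy[OF cov conth him h0 cont1 im1] by metis
  have gK': "g (K (s, x)) = H (s, f x)" if "s \<in> {0..1}" "x \<in> ?A (Suc n)" for s x
    using gK[of "(s, x)"] that by (simp add: h_def)
  have Kim: "K (s, x) \<in> ?B (Suc n)" if "s \<in> {0..1}" "x \<in> ?A (Suc n)" for s x
    using Kim1 gK'[OF that] h[OF that] that unfolding level_domain_Suc[OF bg] h_def
    by (auto simp: level_domain_def)
  have track: "continuous_on {0..1} (\<lambda>s. K (s, x))" "(\<lambda>s. K (s, x)) \<in> {0..1} \<rightarrow> ?B 1"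
    if "x \<in> ?A (Suc n)" for x
    using that Kim1 by (auto intro!: continuous_on_compose2[OF contK] continuous_intros)
  have Htrack: "continuous_on {0..1} (\<lambda>s. H (s, z))" "(\<lambda>s. H (s, z)) \<in> {0..1} \<rightarrow> punctured g"
    if "z \<in> ?A n" for z
    using that Him B0 by (auto intro!: continuous_on_compose2[OF contH] continuous_intros)
  have lift_unique: "\<tau> r = \<tau>' r"
    if z: "z \<in> ?A n"
      and \<tau>: "continuous_on {0..1} \<tau>" "\<tau> \<in> {0..1} \<rightarrow> ?B 1" "\<And>s. s \<in> {0..1} \<Longrightarrow> H (s, z) = g (\<tau> s)"
      and \<tau>': "continuous_on {0..1} \<tau>'" "\<tau>' \<in> {0..1} \<rightarrow> ?B 1" "\<And>s. s \<in> {0..1} \<Longrightarrow> H (s, z) = g (\<tau>' s)"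
      and eq: "\<tau> a = \<tau>' a" and ar: "a \<in> {0..1}" "r \<in> {0..1}" for z \<tau> \<tau>' a and r :: real
    by (rule covering_space_lift_unique[OF cov eq Htrack[OF z] \<tau> \<tau>' _ ar]) simp_all
  have inj: "inj_on (\<lambda>x. K (1, x)) (?A (Suc n))"
  proof (rule inj_onI)
    fix x x' assume x: "x \<in> ?A (Suc n)" "x' \<in> ?A (Suc n)" "K (1, x) = K (1, x')"
    have "H (1, f x) = H (1, f x')"
      using gK'[of 1 x] gK'[of 1 x'] x by simp
    then have "f x = f x'"
      using bij1 fA x(1,2) by (meson bij_betw_imp_inj_on inj_onD)
    then have "H (s, f x) = g (K (s, x))" "H (s, f x) = g (K (s, x'))" if "s \<in> {0..1}" for s
      using gK'[OF that x(1)] gK'[OF that x(2)] by simp_all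
    then have "K (0, x) = K (0, x')"
      using lift_unique[OF fA[OF x(1)] track[OF x(1)] _ track[OF x(2)] _ x(3), of 0] by simp
    then show "x = x'"
      using K0 x(1,2) bijS by (metis bij_betw_imp_inj_on inj_onD)
  qed
  have surj: "y \<in> (\<lambda>x. K (1, x)) ` ?A (Suc n)" if y: "y \<in> ?B (Suc n)" for y
  proof -
    \<comment> \<open>Follow the track of \<open>H\<close> ending at \<open>g y\<close> backwards: its lift from \<open>y\<close> ends at \<open>H (1, x)\<close> for
      the preimage \<open>x\<close> of \<open>y\<close> that is sought.\<close>
    obtain z where z: "z \<in> ?A n" "H (1, z) = g y"
      using gB[OF y] bij1 by (metis bij_betw_def imageE)
    define \<beta> where "\<beta> = reversepath (\<lambda>s. H (s, z))"
    have \<beta>: "path \<beta>" "path_image \<beta> \<subseteq> punctured g" "pathstart \<beta> = g y"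
      using Htrack[OF z(1)] z(2) unfolding \<beta>_def path_image_reversepath path_reversepath pathstart_reversepath
      by (auto simp: path_def path_image_def pathfinish_def)
    obtain \<tau> where \<tau>: "path \<tau>" "path_image \<tau> \<subseteq> ?B 1" "pathstart \<tau> = y"
      and g\<tau>: "\<And>s. s \<in> {0..1} \<Longrightarrow> g (\<tau> s) = \<beta> s"
      using covering_space_lift_path_strong[OF cov _ \<beta>] y B1 by blast
    have "g (\<tau> 1) = H (0, z)" "\<tau> 1 \<in> S2"
      using g\<tau>[of 1] \<tau>(2) pathfinish_in_path_image[of \<tau>]
      by (auto simp: \<beta>_def reversepath_def pathfinish_def level_domain_def)
    then have "\<tau> 1 \<in> ?B (Suc n)"
      using bij_betwE[OF bij0] z(1) unfolding level_domain_Suc[OF bg] by auto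
    then obtain x where x: "x \<in> ?A (Suc n)" "H (1, x) = \<tau> 1"
      using bijS by (metis bij_betw_def imageE)
    have "f x = z"
      using gH[OF x(1)] x(2) \<open>g (\<tau> 1) = H (0, z)\<close> bij0 fA[OF x(1)] z(1)
      by (metis bij_betw_imp_inj_on inj_onD)
    have r: "continuous_on {0..1} (reversepath \<tau>)" "reversepath \<tau> \<in> {0..1} \<rightarrow> ?B 1"
      using \<tau>(1,2) path_image_reversepath[of \<tau>] path_reversepath[of \<tau>]
      unfolding path_def path_image_def by blast+
    have "H (s, f x) = g (reversepath \<tau> s)" if "s \<in> {0..1}" for s
      using g\<tau>[of "1 - s"] that \<open>f x = z\<close> by (simp add: \<beta>_def reversepath_def)
    then have "K (1, x) = reversepath \<tau> 1"
      using lift_unique[OF fA[OF x(1)] track[OF x(1)] _ r, of 0 1] gK'[OF _ x(1)] K0[OF x(1)] x(2)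
      by (simp add: reversepath_def)
    then have "K (1, x) = y"
      using \<tau>(3) by (simp add: reversepath_def pathstart_def)
    then show ?thesis
      using x(1) by blast
  qed
  have bijK1: "bij_betw (\<lambda>x. K (1, x)) (?A (Suc n)) (?B (Suc n))"
    using inj surj Kim unfolding bij_betw_def by auto
  have iff: "x \<in> ?A (Suc (Suc n)) \<longleftrightarrow> K (1, x) \<in> ?B (Suc (Suc n))" if x: "x \<in> ?A (Suc n)" for x
  proof -
    have "f x \<in> ?A (Suc n) \<longleftrightarrow> H (1, f x) \<in> ?B (Suc n)"
    proof
      assume "H (1, f x) \<in> ?B (Suc n)"
      then have "H (1, f x) \<in> (\<lambda>x. H (1, x)) ` ?A (Suc n)"
        unfolding bij_betw_imp_surj_on[OF bijS] .
      then obtain x' where "x' \<in> ?A (Suc n)" "H (1, x') = H (1, f x)"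
        by force
      then show "f x \<in> ?A (Suc n)"
        using bij1 A fA[OF x] by (metis bij_betw_imp_inj_on inj_onD subsetD)
    qed (use bij_betwE[OF bijS] in blast)
    moreover have "x \<in> S2" "K (1, x) \<in> S2"
      using x Kim[OF _ x, of 1] by (auto simp: level_domain_def)
    ultimately show ?thesis
      using gK'[OF _ x, of 1] unfolding level_domain_Suc[OF bf, of "Suc n"] level_domain_Suc[OF bg, of "Suc n"]
      by simp
  qed
  have "level_homotopy f g (Suc n) K"
    unfolding level_homotopy_def
  proof (intro conjI)
    show "K \<in> {0..1} \<times> ?A (Suc n) \<rightarrow> ?B (Suc n)"
      using Kim by fastforce
    show "bij_betw (\<lambda>x. K (0, x)) (?A (Suc n)) (?B (Suc n))"
      using bijS K0 by (simp cong: bij_betw_cong)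
    show "bij_betw (\<lambda>x. K (1, x)) (?A (Suc (Suc n))) (?B (Suc (Suc n)))"
    proof (rule bij_betw_subset[OF bijK1 A])
      show "(\<lambda>x. K (1, x)) ` ?A (Suc (Suc n)) = ?B (Suc (Suc n))"
      proof
        show "(\<lambda>x. K (1, x)) ` ?A (Suc (Suc n)) \<subseteq> ?B (Suc (Suc n))"
          using iff A by blast
        show "?B (Suc (Suc n)) \<subseteq> (\<lambda>x. K (1, x)) ` ?A (Suc (Suc n))"
        proof
          fix y assume y: "y \<in> ?B (Suc (Suc n))"
          then have "y \<in> ?B (Suc n)"
            using level_domain_Suc_subset[OF bg] by blast
          then obtain x where "x \<in> ?A (Suc n)" "y = K (1, x)"
            using surj by blast
          then show "y \<in> (\<lambda>x. K (1, x)) ` ?A (Suc (Suc n))"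
            using iff y by blast
        qed
      qed
    qed
    show "\<forall>x\<in>?A (Suc (Suc n)). g (K (1, x)) = K (0, f x)"
    proof
      fix x assume x: "x \<in> ?A (Suc (Suc n))"
      then show "g (K (1, x)) = K (0, f x)"
        using gK'[of 1 x] K0[OF fA[OF x]] A by auto
    qed
  qed fact+
  then show thesis
    using that K0 by blast
qed

text \<open>The maps \<open>\<psi> n\<close> are the successive lifts of \<open>\<psi>\<^sub>0\<close>, with \<open>\<psi> 1 = \<psi>\<^sub>1\<close>; they are only needed over
  the complements of the postcritical sets.\<close>

lemma level_conjugacies:
  assumes bf: "branched_covering f" and bg: "branched_covering g"
    and ce: "combinatorial_equivalence f g \<psi>\<^sub>0 \<psi>\<^sub>1"
  obtains \<psi> where "\<psi> 0 = \<psi>\<^sub>0"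
    "\<And>n. continuous_on (level_domain f n) (\<psi> n)"
    "\<And>n. bij_betw (\<psi> n) (level_domain f n) (level_domain g n)"
    "\<And>n x. x \<in> level_domain f (Suc n) \<Longrightarrow> g (\<psi> (Suc n) x) = \<psi> n (f x)"
proof -
  \<comment> \<open>\<open>H (Suc n)\<close> lifts \<open>H n\<close> through \<open>g\<close> and starts where \<open>H n\<close> ends.\<close>
  have "\<exists>H. \<forall>n. (level_homotopy f g n (H n) \<and> (n = 0 \<longrightarrow> (\<forall>x. H n (0, x) = \<psi>\<^sub>0 x))) \<and>
      (\<forall>x\<in>level_domain f (Suc n). H (Suc n) (0, x) = H n (1, x))"
  proof (rule dependent_nat_choice[where
        P = "\<lambda>n H. level_homotopy f g n H \<and> (n = 0 \<longrightarrow> (\<forall>x. H (0, x) = \<psi>\<^sub>0 x))" and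
        Q = "\<lambda>n H K. \<forall>x\<in>level_domain f (Suc n). K (0, x) = H (1, x)"])
    show "\<exists>H. level_homotopy f g 0 H \<and> (0 = (0::nat) \<longrightarrow> (\<forall>x. H (0, x) = \<psi>\<^sub>0 x))"
      using combinatorial_equivalence_level_homotopy[OF bf bg ce] by metis
    fix H n assume "level_homotopy f g n H \<and> (n = 0 \<longrightarrow> (\<forall>x. H (0, x) = \<psi>\<^sub>0 x))"
    then show "\<exists>K. (level_homotopy f g (Suc n) K \<and> (Suc n = 0 \<longrightarrow> (\<forall>x. K (0, x) = \<psi>\<^sub>0 x))) \<and>
        (\<forall>x\<in>level_domain f (Suc n). K (0, x) = H (1, x))"
      using level_homotopy_lift[OF bf bg, of n H] by (metis nat.distinct(2))
  qed
  then obtain H where lh: "\<And>n. level_homotopy f g n (H n)" and H0: "\<And>x. H 0 (0, x) = \<psi>\<^sub>0 x"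
    and HS: "\<And>n x. x \<in> level_domain f (Suc n) \<Longrightarrow> H (Suc n) (0, x) = H n (1, x)"
    by blast
  show thesis
  proof (rule that[of "\<lambda>n x. H n (0, x)"])
    show "(\<lambda>x. H 0 (0, x)) = \<psi>\<^sub>0"
      using H0 by blast
    show "continuous_on (level_domain f n) (\<lambda>x. H n (0, x))" for n
    proof (rule continuous_on_compose2[of "{0..1} \<times> level_domain f n" "H n"])
      show "continuous_on ({0..1} \<times> level_domain f n) (H n)"
        using lh unfolding level_homotopy_def by blast
    qed (auto intro!: continuous_intros)
    show "bij_betw (\<lambda>x. H n (0, x)) (level_domain f n) (level_domain g n)" for n
      using lh unfolding level_homotopy_def by blast
    show "g (H (Suc n) (0, x)) = H n (0, f x)" if "x \<in> level_domain f (Suc n)" for n x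
      using lh[of n] HS[OF that] that unfolding level_homotopy_def by auto
  qed
qed

section \<open>The push-forward of the fundamental group\<close>

lemma loop_class_self:
  assumes "\<gamma> \<in> based_loops X t"
  shows "\<gamma> \<in> loop_class X \<gamma>"
  using assms by (simp add: loop_class_def based_loops_def)

lemma loop_class_eq_iff:
  assumes "\<gamma> \<in> based_loops X t"
  shows "loop_class X \<gamma> = loop_class X \<delta> \<longleftrightarrow> homotopic_paths X \<gamma> \<delta>"
proof
  assume "loop_class X \<gamma> = loop_class X \<delta>"
  then show "homotopic_paths X \<gamma> \<delta>"
    using loop_class_self[OF assms] homotopic_paths_sym by (auto simp: loop_class_def)
next
  assume "homotopic_paths X \<gamma> \<delta>"
  then show "loop_class X \<gamma> = loop_class X \<delta>"
    unfolding loop_class_def by (blast intro: homotopic_paths_trans homotopic_paths_sym)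
qed

lemma loop_classD:
  assumes "\<delta> \<in> loop_class X \<gamma>"
  shows "homotopic_paths X \<gamma> \<delta>"
  using assms by (simp add: loop_class_def)

lemma based_loops_join:
  assumes "\<gamma> \<in> based_loops X t" "\<delta> \<in> based_loops X t"
  shows "\<gamma> +++ \<delta> \<in> based_loops X t"
  using assms by (auto simp: based_loops_def path_image_join)

lemma mult_loop_class:
  assumes \<gamma>: "\<gamma> \<in> based_loops X t" and \<delta>: "\<delta> \<in> based_loops X t"
  shows "loop_class X \<gamma> \<otimes>\<^bsub>fundamental_group X t\<^esub> loop_class X \<delta> = loop_class X (\<gamma> +++ \<delta>)"
proof -
  have "loop_class X (\<gamma>' +++ \<delta>') = loop_class X (\<gamma> +++ \<delta>)"
    if "\<gamma>' \<in> loop_class X \<gamma>" "\<delta>' \<in> loop_class X \<delta>" for \<gamma>' \<delta>'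
  proof -
    have "homotopic_paths X (\<gamma> +++ \<delta>) (\<gamma>' +++ \<delta>')"
      using \<gamma> \<delta> by (intro homotopic_paths_join loop_classD that) (auto simp: based_loops_def)
    then show ?thesis
      using loop_class_eq_iff[OF based_loops_join[OF \<gamma> \<delta>]] by blast
  qed
  then have "(\<Union>\<gamma>'\<in>loop_class X \<gamma>. \<Union>\<delta>'\<in>loop_class X \<delta>. loop_class X (\<gamma>' +++ \<delta>')) =
      (\<Union>\<gamma>'\<in>loop_class X \<gamma>. \<Union>\<delta>'\<in>loop_class X \<delta>. loop_class X (\<gamma> +++ \<delta>))"
    by (intro SUP_cong refl)
  also have "\<dots> = loop_class X (\<gamma> +++ \<delta>)"
    using loop_class_self[OF \<gamma>] loop_class_self[OF \<delta>] by blast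
  finally show ?thesis
    by (simp add: fundamental_group_def)
qed

lemma carrier_fundamental_group:
  "carrier (fundamental_group X t) = loop_class X ` based_loops X t"
  by (simp add: fundamental_group_def)

lemma fundamental_group_mult_closed:
  assumes "a \<in> carrier (fundamental_group X t)" "b \<in> carrier (fundamental_group X t)"
  shows "a \<otimes>\<^bsub>fundamental_group X t\<^esub> b \<in> carrier (fundamental_group X t)"
  using assms by (auto simp: carrier_fundamental_group mult_loop_class based_loops_join)

lemma based_loops_image:
  assumes "homeomorphism X Y \<psi> k" "\<gamma> \<in> based_loops X t"
  shows "\<psi> \<circ> \<gamma> \<in> based_loops Y (\<psi> t)"
proof -
  have \<gamma>: "path \<gamma>" "path_image \<gamma> \<subseteq> X" "pathstart \<gamma> = t" "pathfinish \<gamma> = t"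
    using assms(2) unfolding based_loops_def by blast+
  have \<psi>: "continuous_on X \<psi>" "\<psi> ` X = Y"
    using assms(1) unfolding homeomorphism_def by blast+
  have "path (\<psi> \<circ> \<gamma>)"
    using \<gamma> \<psi> by (meson continuous_on_subset path_continuous_image)
  moreover have "path_image (\<psi> \<circ> \<gamma>) \<subseteq> Y"
    using \<gamma> \<psi> unfolding path_image_compose by blast
  ultimately show ?thesis
    using \<gamma> by (simp add: based_loops_def pathstart_def pathfinish_def)
qed

lemma push_forward_loop_class:
  assumes hom: "homeomorphism X Y \<psi> k" and \<gamma>: "\<gamma> \<in> based_loops X t"
  shows "push_forward Y \<psi> (loop_class X \<gamma>) = loop_class Y (\<psi> \<circ> \<gamma>)"
proof -
  have "loop_class Y (\<psi> \<circ> \<gamma>') = loop_class Y (\<psi> \<circ> \<gamma>)" if "\<gamma>' \<in> loop_class X \<gamma>" for \<gamma>'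
  proof -
    have "homotopic_paths Y (\<psi> \<circ> \<gamma>) (\<psi> \<circ> \<gamma>')"
      using hom by (intro homotopic_paths_continuous_image[OF loop_classD[OF that]])
        (auto simp: homeomorphism_def)
    then show ?thesis
      using loop_class_eq_iff[OF based_loops_image[OF assms]] by blast
  qed
  then show ?thesis
    using loop_class_self[OF \<gamma>] unfolding push_forward_def by blast
qed

text \<open>A homeomorphism of spaces induces an isomorphism of fundamental groups.\<close>

lemma push_forward_iso:
  assumes hom: "homeomorphism X Y \<psi> k" and t: "t \<in> X"
  shows "push_forward Y \<psi> \<in> iso (fundamental_group X t) (fundamental_group Y (\<psi> t))"
proof (rule isoI)
  note pf = push_forward_loop_class[OF hom] and im = based_loops_image[OF hom]
  have kY: "\<psi> (k y) = y" if "y \<in> Y" for y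
    using hom that by (rule homeomorphism_apply2)
  have kX: "k (\<psi> x) = x" if "x \<in> X" for x
    using hom that by (rule homeomorphism_apply1)
  have surj: "homotopic_paths Y (\<psi> \<circ> (k \<circ> \<delta>)) \<delta>" if "\<delta> \<in> based_loops Y s" for \<delta> s
  proof (rule homotopic_paths_sym, rule homotopic_paths_eq)
    show "path \<delta>" and Y: "path_image \<delta> \<subseteq> Y"
      using that by (auto simp: based_loops_def)
    show "\<delta> r = (\<psi> \<circ> (k \<circ> \<delta>)) r" if "r \<in> {0..1}" for r
    proof -
      have "\<delta> r \<in> Y"
        using Y that unfolding path_image_def by blast
      then show ?thesis
        using kY by simp
    qed
  qed
  show "push_forward Y \<psi> \<in> hom (fundamental_group X t) (fundamental_group Y (\<psi> t))"
  proof (rule homI)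
    fix a assume "a \<in> carrier (fundamental_group X t)"
    then show "push_forward Y \<psi> a \<in> carrier (fundamental_group Y (\<psi> t))"
      using pf im by (auto simp: carrier_fundamental_group)
  next
    fix a b assume "a \<in> carrier (fundamental_group X t)" "b \<in> carrier (fundamental_group X t)"
    then obtain \<gamma> \<delta> where \<gamma>: "\<gamma> \<in> based_loops X t" "a = loop_class X \<gamma>"
      and \<delta>: "\<delta> \<in> based_loops X t" "b = loop_class X \<delta>"
      unfolding carrier_fundamental_group by blast
    show "push_forward Y \<psi> (a \<otimes>\<^bsub>fundamental_group X t\<^esub> b) =
        push_forward Y \<psi> a \<otimes>\<^bsub>fundamental_group Y (\<psi> t)\<^esub> push_forward Y \<psi> b"
      unfolding \<gamma>(2) \<delta>(2) mult_loop_class[OF \<gamma>(1) \<delta>(1)] pf[OF \<gamma>(1)] pf[OF \<delta>(1)]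
        pf[OF based_loops_join[OF \<gamma>(1) \<delta>(1)]] mult_loop_class[OF im[OF \<gamma>(1)] im[OF \<delta>(1)]]
        path_compose_join ..
  qed
  show "bij_betw (push_forward Y \<psi>) (carrier (fundamental_group X t)) (carrier (fundamental_group Y (\<psi> t)))"
    unfolding carrier_fundamental_group
  proof (rule bij_betw_imageI)
    show "inj_on (push_forward Y \<psi>) (loop_class X ` based_loops X t)"
    proof (rule inj_onI, elim imageE)
      fix a b \<gamma> \<delta>
      assume eq: "push_forward Y \<psi> a = push_forward Y \<psi> b" and a: "a = loop_class X \<gamma>"
        and \<gamma>: "\<gamma> \<in> based_loops X t" and b: "b = loop_class X \<delta>" and \<delta>: "\<delta> \<in> based_loops X t"
      have "homotopic_paths Y (\<psi> \<circ> \<gamma>) (\<psi> \<circ> \<delta>)"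
        using eq unfolding a b pf[OF \<gamma>] pf[OF \<delta>] loop_class_eq_iff[OF im[OF \<gamma>]] .
      then have h: "homotopic_paths X (k \<circ> (\<psi> \<circ> \<gamma>)) (k \<circ> (\<psi> \<circ> \<delta>))"
        using hom by (intro homotopic_paths_continuous_image[of Y]) (auto simp: homeomorphism_def)
      have "homotopic_paths X \<epsilon> (k \<circ> (\<psi> \<circ> \<epsilon>))" if "\<epsilon> \<in> based_loops X t" for \<epsilon>
      proof (rule homotopic_paths_eq)
        show "path \<epsilon>" and X: "path_image \<epsilon> \<subseteq> X"
          using that by (auto simp: based_loops_def)
        show "\<epsilon> r = (k \<circ> (\<psi> \<circ> \<epsilon>)) r" if "r \<in> {0..1}" for r
        proof -
          have "\<epsilon> r \<in> X"
            using X that unfolding path_image_def by blast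
          then show ?thesis
            using kX by simp
        qed
      qed
      from this[OF \<gamma>] h this[OF \<delta>] have "homotopic_paths X \<gamma> \<delta>"
        by (meson homotopic_paths_sym homotopic_paths_trans)
      then show "a = b"
        using a b loop_class_eq_iff[OF \<gamma>] by blast
    qed
    show "push_forward Y \<psi> ` loop_class X ` based_loops X t = loop_class Y ` based_loops Y (\<psi> t)"
    proof
      show "push_forward Y \<psi> ` loop_class X ` based_loops X t \<subseteq> loop_class Y ` based_loops Y (\<psi> t)"
        using pf im by auto
      show "loop_class Y ` based_loops Y (\<psi> t) \<subseteq> push_forward Y \<psi> ` loop_class X ` based_loops X t"
      proof (rule image_subsetI)
        fix \<delta> assume \<delta>: "\<delta> \<in> based_loops Y (\<psi> t)"
        have k\<delta>: "k \<circ> \<delta> \<in> based_loops X t"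
          using based_loops_image[OF homeomorphism_symD[OF hom] \<delta>] kX[OF t] by simp
        have "push_forward Y \<psi> (loop_class X (k \<circ> \<delta>)) = loop_class Y \<delta>"
          unfolding pf[OF k\<delta>] loop_class_eq_iff[OF im[OF k\<delta>]] by (rule surj[OF \<delta>])
        then show "loop_class Y \<delta> \<in> push_forward Y \<psi> ` loop_class X ` based_loops X t"
          using k\<delta> by (metis imageI)
      qed
    qed
  qed
qed

text \<open>For the coset structure alone, closure under multiplication suffices; no group axiom and no
  normality of \<open>K\<close> enters.\<close>

lemma iso_FactGroup_image:
  assumes iso: "\<phi> \<in> iso G H" and K: "K \<subseteq> carrier G"
    and closed: "\<And>a b. a \<in> carrier G \<Longrightarrow> b \<in> carrier G \<Longrightarrow> a \<otimes>\<^bsub>G\<^esub> b \<in> carrier G"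
  shows "(\<lambda>C. \<phi> ` C) \<in> iso (G Mod K) (H Mod (\<phi> ` K))"
proof (rule isoI)
  have mult: "\<phi> (a \<otimes>\<^bsub>G\<^esub> b) = \<phi> a \<otimes>\<^bsub>H\<^esub> \<phi> b" if "a \<in> carrier G" "b \<in> carrier G" for a b
    using iso that by (auto simp: iso_def hom_def)
  have bij: "bij_betw \<phi> (carrier G) (carrier H)"
    using iso by (simp add: iso_def)
  have sub: "C \<subseteq> carrier G" if "C \<in> rcosets\<^bsub>G\<^esub> K" for C
    using that K closed by (auto simp: RCOSETS_def r_coset_def)
  have coset: "\<phi> ` (K #>\<^bsub>G\<^esub> a) = \<phi> ` K #>\<^bsub>H\<^esub> \<phi> a" if "a \<in> carrier G" for a
  proof -
    have "\<phi> ` (K #>\<^bsub>G\<^esub> a) = (\<lambda>x. \<phi> (x \<otimes>\<^bsub>G\<^esub> a)) ` K"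
      unfolding r_coset_def by blast
    also have "\<dots> = (\<lambda>x. \<phi> x \<otimes>\<^bsub>H\<^esub> \<phi> a) ` K"
      using mult that K by (intro image_cong refl) blast
    also have "\<dots> = \<phi> ` K #>\<^bsub>H\<^esub> \<phi> a"
      unfolding r_coset_def by blast
    finally show ?thesis .
  qed
  have image: "(\<lambda>C. \<phi> ` C) ` (rcosets\<^bsub>G\<^esub> K) = rcosets\<^bsub>H\<^esub> (\<phi> ` K)"
  proof -
    have "(\<lambda>C. \<phi> ` C) ` (rcosets\<^bsub>G\<^esub> K) = (\<lambda>a. \<phi> ` K #>\<^bsub>H\<^esub> \<phi> a) ` carrier G"
    proof -
      have "rcosets\<^bsub>G\<^esub> K = (\<lambda>a. K #>\<^bsub>G\<^esub> a) ` carrier G"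
        unfolding RCOSETS_def by blast
      then show ?thesis
        using coset by (simp add: image_image)
    qed
    also have "\<dots> = (\<lambda>b. \<phi> ` K #>\<^bsub>H\<^esub> b) ` \<phi> ` carrier G"
      by (simp add: image_image)
    also have "\<dots> = rcosets\<^bsub>H\<^esub> (\<phi> ` K)"
      using bij by (auto simp: RCOSETS_def bij_betw_def)
    finally show ?thesis .
  qed
  show "(\<lambda>C. \<phi> ` C) \<in> hom (G Mod K) (H Mod (\<phi> ` K))"
  proof (rule homI)
    fix C assume "C \<in> carrier (G Mod K)"
    then show "\<phi> ` C \<in> carrier (H Mod (\<phi> ` K))"
      using image by (auto simp: FactGroup_def)
  next
    fix C D assume "C \<in> carrier (G Mod K)" "D \<in> carrier (G Mod K)"
    then have "C \<subseteq> carrier G" "D \<subseteq> carrier G"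
      using sub by (auto simp: FactGroup_def)
    then have "\<phi> ` (C <#>\<^bsub>G\<^esub> D) = \<phi> ` C <#>\<^bsub>H\<^esub> \<phi> ` D"
      (is "?l = ?r")
    proof -
      have "?l = (\<Union>x\<in>C. \<Union>y\<in>D. {\<phi> (x \<otimes>\<^bsub>G\<^esub> y)})"
        unfolding set_mult_def by blast
      also have "\<dots> = (\<Union>x\<in>C. \<Union>y\<in>D. {\<phi> x \<otimes>\<^bsub>H\<^esub> \<phi> y})"
        using mult \<open>C \<subseteq> carrier G\<close> \<open>D \<subseteq> carrier G\<close> by (intro SUP_cong refl) auto
      also have "\<dots> = ?r"
        unfolding set_mult_def by blast
      finally show ?thesis .
    qed
    then show "\<phi> ` (C \<otimes>\<^bsub>G Mod K\<^esub> D) = \<phi> ` C \<otimes>\<^bsub>H Mod (\<phi> ` K)\<^esub> \<phi> ` D"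
      by (simp add: FactGroup_def)
  qed
  have "inj_on (\<lambda>C. \<phi> ` C) (rcosets\<^bsub>G\<^esub> K)"
    using sub bij by (intro inj_onI) (metis bij_betw_def inj_on_image_eq_iff)
  then show "bij_betw (\<lambda>C. \<phi> ` C) (carrier (G Mod K)) (carrier (H Mod (\<phi> ` K)))"
    using image by (simp add: bij_betw_def FactGroup_def)
qed

section \<open>Tree isomorphism and conjugate monodromy actions\<close>

text \<open>Fibrewise bijections that commute with \<open>f\<close> and \<open>g\<close> assemble to a tree isomorphism.\<close>

lemma tree_isomorphism_levelwise:
  assumes bf: "branched_covering f" and bg: "branched_covering g"
    and bij: "\<And>n. bij_betw (\<psi> n) {x \<in> S2. (f ^^ n) x = t} {y \<in> S2. (g ^^ n) y = s}"
    and comm: "\<And>n x. x \<in> S2 \<Longrightarrow> (f ^^ Suc n) x = t \<Longrightarrow> g (\<psi> (Suc n) x) = \<psi> n (f x)"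
  shows "tree_isomorphism f t g s (\<lambda>(n, x). (n, \<psi> n x))"
proof -
  let ?h = "\<lambda>(n, x). (n, \<psi> n x)"
  let ?F = "\<lambda>n. {x \<in> S2. (f ^^ n) x = t}" and ?G = "\<lambda>n. {y \<in> S2. (g ^^ n) y = s}"
  have TF: "tree_vertices f t = Sigma UNIV ?F" and TG: "tree_vertices g s = Sigma UNIV ?G"
    by (auto simp: tree_vertices_def)
  have fF: "f x \<in> ?F n" if "x \<in> ?F (Suc n)" for n x
    using that branched_covering_S2[OF bf, of x] by (simp add: funpow_swap1)
  have inj: "x = x'" if "x \<in> ?F n" "x' \<in> ?F n" "\<psi> n x = \<psi> n x'" for n x x'
    using that bij[of n] by (meson bij_betw_imp_inj_on inj_onD)
  have \<psi>G: "\<psi> n x \<in> ?G n" if "x \<in> ?F n" for n x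
    using that bij_betwE[OF bij[of n]] by blast
  have surj: "\<exists>x\<in>?F n. y = \<psi> n x" if "y \<in> ?G n" for n y
    using that bij[of n] unfolding bij_betw_def by blast
  have edge: "{?h u, ?h v} \<in> tree_edges g s" if "{u, v} \<in> tree_edges f t" for u v
  proof -
    obtain n x where uv: "{u, v} = {(n, f x), (Suc n, x)}" and x: "x \<in> ?F (Suc n)"
      using \<open>{u, v} \<in> tree_edges f t\<close> unfolding tree_edges_def TF by blast
    have "{?h u, ?h v} = ?h ` {u, v}"
      by blast
    also have "\<dots> = {(n, g (\<psi> (Suc n) x)), (Suc n, \<psi> (Suc n) x)}"
      unfolding uv using comm[of x n] x by auto
    finally show ?thesis
      using \<psi>G[OF x] unfolding tree_edges_def TG by blast
  qed
  have down: "{u, v} \<in> tree_edges f t"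
    if uv: "u \<in> tree_vertices f t" "v \<in> tree_vertices f t"
      and h: "?h u = (n, g y)" "?h v = (Suc n, y)" for u v n y
  proof -
    obtain x' x where u: "u = (n, x')" "\<psi> n x' = g y" and v: "v = (Suc n, x)" "\<psi> (Suc n) x = y"
      using h by (cases u, cases v) auto
    have xF: "x' \<in> ?F n" "x \<in> ?F (Suc n)"
      using uv unfolding TF u v by auto
    then have "x' = f x"
      using inj[OF xF(1) fF[OF xF(2)]] comm[of x n] u(2) v(2) by auto
    then show ?thesis
      using uv(2) unfolding tree_edges_def u v by blast
  qed
  have up: "{u, v} \<in> tree_edges f t"
    if uv: "u \<in> tree_vertices f t" "v \<in> tree_vertices f t" and h: "{?h u, ?h v} \<in> tree_edges g s" for u v
  proof -
    obtain n y where "{?h u, ?h v} = {(n, g y), (Suc n, y)}"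
      using h unfolding tree_edges_def by blast
    then consider "?h u = (n, g y)" "?h v = (Suc n, y)" | "?h v = (n, g y)" "?h u = (Suc n, y)"
      unfolding doubleton_eq_iff by blast
    then show ?thesis
    proof cases
      case 1
      then show ?thesis
        by (rule down[OF uv])
    next
      case 2
      then have "{v, u} \<in> tree_edges f t"
        by (rule down[OF uv(2,1)])
      then show ?thesis
        by (simp only: insert_commute)
    qed
  qed
  have "bij_betw ?h (tree_vertices f t) (tree_vertices g s)"
  proof (rule bij_betw_imageI)
    show "inj_on ?h (tree_vertices f t)"
      using inj unfolding TF by (intro inj_onI) auto
    show "?h ` tree_vertices f t = tree_vertices g s"
    proof
      show "?h ` tree_vertices f t \<subseteq> tree_vertices g s"
        using \<psi>G unfolding TF TG by auto
      show "tree_vertices g s \<subseteq> ?h ` tree_vertices f t"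
      proof
        fix w assume w: "w \<in> tree_vertices g s"
        obtain n y where ny: "w = (n, y)"
          by (cases w)
        then have "y \<in> ?G n"
          using w by (simp add: tree_vertices_def)
        then obtain x where "x \<in> ?F n" "y = \<psi> n x"
          using surj by blast
        then show "w \<in> ?h ` tree_vertices f t"
          using ny by (intro image_eqI[of _ _ "(n, x)"]) (auto simp: tree_vertices_def)
      qed
    qed
  qed
  then show ?thesis
    using edge up unfolding tree_isomorphism_def by (auto split: prod.split)
qed

text \<open>Since \<open>g\<^sup>n \<circ> \<psi> n = \<psi>\<^sub>0 \<circ> f\<^sup>n\<close>, the map \<open>\<psi> n\<close> carries the \<open>f\<^sup>n\<close>-lifts of \<open>\<gamma>\<close> to the
  \<open>g\<^sup>n\<close>-lifts of \<open>\<psi>\<^sub>0 \<circ> \<gamma>\<close>.\<close>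

lemma monodromy_conjugate:
  assumes bf: "branched_covering f" and bg: "branched_covering g"
    and ce: "combinatorial_equivalence f g \<psi>\<^sub>0 \<psi>\<^sub>1" and t: "t \<in> punctured f"
    and hom: "homeomorphism (punctured f) (punctured g) \<psi>\<^sub>0 k"
  obtains h where "tree_isomorphism f t g (\<psi>\<^sub>0 t) h"
    "\<And>\<gamma> v. \<gamma> \<in> based_loops (punctured f) t \<Longrightarrow> v \<in> tree_vertices f t \<Longrightarrow>
      monodromy g (\<psi>\<^sub>0 t) (loop_class (punctured g) (\<psi>\<^sub>0 \<circ> \<gamma>)) (h v) =
      h (monodromy f t (loop_class (punctured f) \<gamma>) v)"
proof -
  obtain \<psi> where \<psi>0: "\<psi> 0 = \<psi>\<^sub>0"
    and cont: "\<And>n. continuous_on (level_domain f n) (\<psi> n)"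
    and bij: "\<And>n. bij_betw (\<psi> n) (level_domain f n) (level_domain g n)"
    and comm: "\<And>n x. x \<in> level_domain f (Suc n) \<Longrightarrow> g (\<psi> (Suc n) x) = \<psi> n (f x)"
    by (rule level_conjugacies[OF bf bg ce]) (rule that)
  let ?F = "\<lambda>n. {x \<in> S2. (f ^^ n) x = t}" and ?G = "\<lambda>n. {y \<in> S2. (g ^^ n) y = \<psi>\<^sub>0 t}"
  have semiconj: "(g ^^ n) (\<psi> n x) = \<psi>\<^sub>0 ((f ^^ n) x)" if "x \<in> level_domain f n" for n x
    using that
  proof (induction n arbitrary: x)
    case 0
    then show ?case
      by (simp add: \<psi>0)
  next
    case (Suc n)
    then have "f x \<in> level_domain f n"
      using level_domain_Suc[OF bf] by blast
    then show ?case
      using Suc comm[of x n] by (simp add: funpow_swap1)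
  qed
  have FA: "?F n \<subseteq> level_domain f n" for n
    using t by (auto simp: level_domain_def)
  have s: "\<psi>\<^sub>0 t \<in> punctured g"
    using hom t homeomorphism_image1 by blast
  have fib: "bij_betw (\<psi> n) (?F n) (?G n)" for n
  proof (rule bij_betw_subset[OF bij FA])
    have iff: "(f ^^ n) x = t \<longleftrightarrow> (g ^^ n) (\<psi> n x) = \<psi>\<^sub>0 t" if x: "x \<in> level_domain f n" for x
    proof -
      have "(f ^^ n) x \<in> punctured f"
        using x unfolding level_domain_def by blast
      then show ?thesis
        using semiconj[OF x] t homeomorphism_apply1[OF hom] by metis
    qed
    show "\<psi> n ` ?F n = ?G n"
    proof
      show "\<psi> n ` ?F n \<subseteq> ?G n"
      proof (rule image_subsetI)
        fix x assume x: "x \<in> ?F n"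
        then have "\<psi> n x \<in> level_domain g n"
          using FA bij_betwE[OF bij] by blast
        then show "\<psi> n x \<in> ?G n"
          using iff[of x] x FA unfolding level_domain_def by blast
      qed
      show "?G n \<subseteq> \<psi> n ` ?F n"
      proof
        fix y assume y: "y \<in> ?G n"
        then have "y \<in> level_domain g n"
          using s by (auto simp: level_domain_def)
        then obtain x where x: "x \<in> level_domain f n" "y = \<psi> n x"
          using bij unfolding bij_betw_def by blast
        then have "x \<in> ?F n"
          using iff[OF x(1)] y unfolding level_domain_def by blast
        then show "y \<in> \<psi> n ` ?F n"
          using x(2) by blast
      qed
    qed
  qed
  let ?h = "\<lambda>(n, x). (n, \<psi> n x)"
  show thesis
  proof
    show "tree_isomorphism f t g (\<psi>\<^sub>0 t) ?h"
    proof (rule tree_isomorphism_levelwise[OF bf bg fib])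
      show "g (\<psi> (Suc n) x) = \<psi> n (f x)" if "x \<in> S2" "(f ^^ Suc n) x = t" for n x
        using comm FA[of "Suc n"] that by blast
    qed
    fix \<gamma> v assume \<gamma>: "\<gamma> \<in> based_loops (punctured f) t" and v: "v \<in> tree_vertices f t"
    obtain n x where nx: "v = (n, x)"
      by (cases v)
    obtain \<sigma> where \<sigma>: "is_lift f n \<gamma> \<sigma>" "pathstart \<sigma> = x"
      and mf: "monodromy f t (loop_class (punctured f) \<gamma>) (n, x) = (n, pathfinish \<sigma>)"
      using monodromy_lift[OF bf \<gamma>, of n x] v nx by metis
    have \<sigma>A: "path_image \<sigma> \<subseteq> level_domain f n" "path \<sigma>"
      and f\<sigma>: "\<And>r. r \<in> {0..1} \<Longrightarrow> (f ^^ n) (\<sigma> r) = \<gamma> r"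
      using \<sigma>(1) unfolding is_lift_def level_domain_def by blast+
    have im: "path_image (\<psi> n \<circ> \<sigma>) \<subseteq> level_domain g n"
      using \<sigma>A bij_betwE[OF bij] unfolding path_image_compose by blast
    have lift: "is_lift g n (\<psi>\<^sub>0 \<circ> \<gamma>) (\<psi> n \<circ> \<sigma>)"
      unfolding is_lift_def
    proof (intro conjI ballI)
      show "path (\<psi> n \<circ> \<sigma>)"
        using \<sigma>A cont by (meson continuous_on_subset path_continuous_image)
      show "path_image (\<psi> n \<circ> \<sigma>) \<subseteq> S2 \<inter> (g ^^ n) -` punctured g"
        using im unfolding level_domain_def by blast
      fix r :: real assume r: "r \<in> {0..1}"
      then have "\<sigma> r \<in> level_domain f n"
        using \<sigma>A unfolding path_image_def by blast
      then show "(g ^^ n) ((\<psi> n \<circ> \<sigma>) r) = (\<psi>\<^sub>0 \<circ> \<gamma>) r"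
        using semiconj f\<sigma>[OF r] by simp
    qed
    have "\<psi>\<^sub>0 \<circ> \<gamma> \<in> based_loops (punctured g) (\<psi>\<^sub>0 t)"
      by (rule based_loops_image[OF hom \<gamma>])
    then have "monodromy_endpoint g n (loop_class (punctured g) (\<psi>\<^sub>0 \<circ> \<gamma>)) (\<psi> n x) = \<psi> n (pathfinish \<sigma>)"
      using monodromy_endpoint_eq[OF bg lift] \<sigma>(2) unfolding based_loops_def
      by (simp add: pathstart_def pathfinish_def)
    moreover have "(n, \<psi> n x) \<in> tree_vertices g (\<psi>\<^sub>0 t)"
      using bij_betwE[OF fib, of n] v nx unfolding tree_vertices_def by blast
    ultimately show "monodromy g (\<psi>\<^sub>0 t) (loop_class (punctured g) (\<psi>\<^sub>0 \<circ> \<gamma>)) (?h v) =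
        ?h (monodromy f t (loop_class (punctured f) \<gamma>) v)"
      unfolding nx mf by (simp add: monodromy_def)
  qed
qed

section \<open>The kernels of the monodromy actions\<close>

lemma mem_monodromy_kernel_iff:
  assumes "A \<in> carrier (fundamental_group (punctured f) t)"
  shows "A \<in> monodromy_kernel f t \<longleftrightarrow> (\<forall>v\<in>tree_vertices f t. monodromy f t A v = v)"
proof -
  have "monodromy f t A = (\<lambda>v\<in>tree_vertices f t. v) \<longleftrightarrow> (\<forall>v\<in>tree_vertices f t. monodromy f t A v = v)"
    by (auto simp: fun_eq_iff monodromy_def restrict_def)
  then show ?thesis
    using assms by (simp add: monodromy_kernel_def kernel_def tree_aut_group_def)
qed

theorem proposition4:
  fixes f g \<psi>\<^sub>0 \<psi>\<^sub>1 :: "real^3 \<Rightarrow> real^3" and t :: "real^3"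
  assumes "branched_covering f" and "postcritically_finite f" and "2 \<le> covering_degree f"
    and "branched_covering g" and "postcritically_finite g" and "2 \<le> covering_degree g"
    and "combinatorial_equivalence f g \<psi>\<^sub>0 \<psi>\<^sub>1"
    and "t \<in> punctured f"
  shows "push_forward (punctured g) \<psi>\<^sub>0 ` monodromy_kernel f t = monodromy_kernel g (\<psi>\<^sub>0 t) \<and>
    fundamental_group (punctured g) (\<psi>\<^sub>0 t) Mod (push_forward (punctured g) \<psi>\<^sub>0 ` monodromy_kernel f t)
      = IMG g (\<psi>\<^sub>0 t) \<and>
    (\<lambda>C. push_forward (punctured g) \<psi>\<^sub>0 ` C) \<in> iso (IMG f t) (IMG g (\<psi>\<^sub>0 t)) \<and>
    (\<exists>h. tree_isomorphism f t g (\<psi>\<^sub>0 t) h \<and>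
      (\<forall>\<gamma> \<in> based_loops (punctured f) t. \<forall>v \<in> tree_vertices f t.
        monodromy g (\<psi>\<^sub>0 t) (loop_class (punctured g) (\<psi>\<^sub>0 \<circ> \<gamma>)) (h v) =
        h (monodromy f t (loop_class (punctured f) \<gamma>) v)))"
proof -
  let ?X = "punctured f" and ?Y = "punctured g"
  let ?G = "fundamental_group ?X t" and ?H = "fundamental_group ?Y (\<psi>\<^sub>0 t)"
  let ?\<phi> = "push_forward ?Y \<psi>\<^sub>0"
  note bf = assms(1) and bg = assms(4) and ce = assms(7) and t = assms(8)
  obtain k where hS: "homeomorphism S2 S2 \<psi>\<^sub>0 k"
    using ce unfolding combinatorial_equivalence_def orientation_preserving_homeo_def sphere_homeo_def
    by blast
  have "\<psi>\<^sub>0 ` ?X = ?Y"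
  proof -
    have "\<psi>\<^sub>0 ` postcritical_set f = postcritical_set g"
      using ce unfolding combinatorial_equivalence_def by blast
    moreover have "inj_on \<psi>\<^sub>0 S2" "\<psi>\<^sub>0 ` S2 = S2"
      using hS by (auto intro: inj_on_inverseI simp: homeomorphism_def)
    ultimately show ?thesis
      using postcritical_set_subset_S2[OF bf] inj_on_image_set_diff[of \<psi>\<^sub>0 S2 S2 "postcritical_set f"]
      by simp
  qed
  then have hom: "homeomorphism ?X ?Y \<psi>\<^sub>0 k"
    using homeomorphism_of_subsets[OF hS, of ?X ?Y ?Y] by blast
  obtain h where h: "tree_isomorphism f t g (\<psi>\<^sub>0 t) h"
    and conj: "\<And>\<gamma> v. \<gamma> \<in> based_loops ?X t \<Longrightarrow> v \<in> tree_vertices f t \<Longrightarrow>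
      monodromy g (\<psi>\<^sub>0 t) (loop_class ?Y (\<psi>\<^sub>0 \<circ> \<gamma>)) (h v) = h (monodromy f t (loop_class ?X \<gamma>) v)"
    by (rule monodromy_conjugate[OF bf bg ce t hom]) blast
  have iso: "?\<phi> \<in> iso ?G ?H"
    by (rule push_forward_iso[OF hom t])
  have bij: "bij_betw h (tree_vertices f t) (tree_vertices g (\<psi>\<^sub>0 t))"
    using h unfolding tree_isomorphism_def by blast
  have ker: "?\<phi> A \<in> monodromy_kernel g (\<psi>\<^sub>0 t) \<longleftrightarrow> A \<in> monodromy_kernel f t" if A: "A \<in> carrier ?G" for A
  proof -
    obtain \<gamma> where \<gamma>: "\<gamma> \<in> based_loops ?X t" "A = loop_class ?X \<gamma>"
      using A unfolding carrier_fundamental_group by blast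
    have \<phi>A: "?\<phi> A = loop_class ?Y (\<psi>\<^sub>0 \<circ> \<gamma>)"
      unfolding \<gamma>(2) by (rule push_forward_loop_class[OF hom \<gamma>(1)])
    have "?\<phi> A \<in> carrier ?H"
      using A iso by (auto simp: iso_def hom_def)
    then have "?\<phi> A \<in> monodromy_kernel g (\<psi>\<^sub>0 t) \<longleftrightarrow>
        (\<forall>w\<in>tree_vertices g (\<psi>\<^sub>0 t). monodromy g (\<psi>\<^sub>0 t) (?\<phi> A) w = w)"
      by (rule mem_monodromy_kernel_iff)
    also have "\<dots> \<longleftrightarrow> (\<forall>v\<in>tree_vertices f t. monodromy g (\<psi>\<^sub>0 t) (?\<phi> A) (h v) = h v)"
      unfolding bij_betw_imp_surj_on[OF bij, symmetric] by blast
    also have "\<dots> \<longleftrightarrow> (\<forall>v\<in>tree_vertices f t. h (monodromy f t A v) = h v)"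
      using conj[OF \<gamma>(1), folded \<phi>A \<gamma>(2)] by simp
    also have "\<dots> \<longleftrightarrow> (\<forall>v\<in>tree_vertices f t. monodromy f t A v = v)"
    proof (intro ball_cong refl)
      fix v assume v: "v \<in> tree_vertices f t"
      have "monodromy f t A v \<in> tree_vertices f t"
        using monodromy_lift[OF bf \<gamma>(1), of "fst v" "snd v"] v unfolding \<gamma>(2) by (metis prod.collapse)
      then show "h (monodromy f t A v) = h v \<longleftrightarrow> monodromy f t A v = v"
        using v bij by (metis bij_betw_imp_inj_on inj_onD)
    qed
    also have "\<dots> \<longleftrightarrow> A \<in> monodromy_kernel f t"
      using mem_monodromy_kernel_iff[OF A] by blast
    finally show ?thesis .
  qed
  have Kf: "monodromy_kernel f t \<subseteq> carrier ?G" and Kg: "monodromy_kernel g (\<psi>\<^sub>0 t) \<subseteq> carrier ?H"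
    by (auto simp: monodromy_kernel_def kernel_def)
  have K: "?\<phi> ` monodromy_kernel f t = monodromy_kernel g (\<psi>\<^sub>0 t)"
  proof
    show "?\<phi> ` monodromy_kernel f t \<subseteq> monodromy_kernel g (\<psi>\<^sub>0 t)"
      using ker Kf by blast
    show "monodromy_kernel g (\<psi>\<^sub>0 t) \<subseteq> ?\<phi> ` monodromy_kernel f t"
    proof
      fix B assume B: "B \<in> monodromy_kernel g (\<psi>\<^sub>0 t)"
      then obtain A where "A \<in> carrier ?G" "B = ?\<phi> A"
        using Kg iso unfolding iso_def bij_betw_def by blast
      then show "B \<in> ?\<phi> ` monodromy_kernel f t"
        using ker B by blast
    qed
  qed
  have "(\<lambda>C. ?\<phi> ` C) \<in> iso (IMG f t) (IMG g (\<psi>\<^sub>0 t))"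
    unfolding IMG_def K[symmetric]
    by (rule iso_FactGroup_image[OF iso Kf fundamental_group_mult_closed])
  then show ?thesis
    using K h conj unfolding IMG_def by auto
qed

end
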